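(* Let $(M,g)$ be an $n$-dimensional Riemannian manifold ($n\ge 3$), $(B,g_B)$ a Riemannian vector bundle over $M$ of rank $m-n$, and $\zeta$ a $B$-valued symmetric $(1,2)$-tensor field on $M$. Let $T$ be a curvature-like tensor field on $M$ satisfying the algebraic Gauss equation $$T(X,Y,Z,W)=g_B(\zeta(X,W),\zeta(Y,Z))-g_B(\zeta(X,Z),\zeta(Y,W))$$ for all vector fields $X,Y,Z,W$ on $M$. Then for every $p\in M$ the $T$-normalized scalar curvature is bounded above by the algebraic Casorati curvature $\widehat\delta_{\mathcal C^{T,\zeta}}(n-1)$: $$(\tau_T)_{\rm Nor}(p)\le[\widehat\delta_{\mathcal C^{T,\zeta}}(n-1)]_p.$$ Moreover, if $\sup\{\mathcal C^{T,\zeta}(\Pi_{n-1}):\Pi_{n-1}\text{ is a hyperplane of }T_pM\}$ is attained by a hyperplane $\Pi_{n-1}$ of $T_pM$, then equality holds at $p$ if and only if, with respect to a suitable orthonormal basis $\{e_1,\dots,e_n\}$ of $T_pM$ and a suitable orthonormal basis $\{e_{n+1},\dots,e_m\}$ of the fibre $B_p$, the components $\zeta_{ij}^\alpha=g_B(\zeta(e_i,e_j),e_\alpha)$ satisfy $$\zeta_{ij}^\alpha=0\qquad (i,j\in\{1,\dots,n\},\ i\ne j,\ \alpha\in\{n+1,\dots,m\}),$$ $$\zeta_{11}^\alpha=\zeta_{22}^\alpha=\cdots=\zeta_{n-1\,n-1}^\alpha=2\,\zeta_{nn}^\alpha\qquad(\alpha\in\{n+1,\dots,m\}).$$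
   Context: A $B$-valued symmetric $(1,2)$-tensor field $\zeta$ on $M$ assigns to each $p$ a symmetric bilinear map $T_pM\times T_pM\to B_p$. A curvature-like tensor field is a $(0,4)$-tensor field $T$ with $T(X,Y,Z,W)=-T(Y,X,Z,W)$, $T(X,Y,Z,W)=T(Z,W,X,Y)$ and $T(X,Y,Z,W)+T(Y,Z,X,W)+T(Z,X,Y,W)=0$. The $T$-scalar curvature at $p$ is $\tau_T(p)=\sum_{1\le i<j\le n}T(e_i,e_j,e_j,e_i)$ for any orthonormal basis $\{e_1,\dots,e_n\}$ of $T_pM$, and the $T$-normalized scalar curvature is $(\tau_T)_{\rm Nor}(p)=\frac{2}{n(n-1)}\tau_T(p)$. For a $k$-dimensional subspace $\Pi_k\subset T_pM$, $k\ge2$, with orthonormal basis $\{e_1,\dots,e_k\}$ and an orthonormal basis $\{e_{n+1},\dots,e_m\}$ of $B_p$, the algebraic Casorati curvature of $\Pi_k$ is $\mathcal C^{T,\zeta}(\Pi_k)=\frac1k\sum_{\alpha=n+1}^m\sum_{i,j=1}^k(\zeta_{ij}^\alpha)^2$, where $\zeta_{ij}^\alpha=g_B(\zeta(e_i,e_j),e_\alpha)$. Put $\mathcal C^{T,\zeta}_p=\mathcal C^{T,\zeta}(T_pM)=\frac1n\|\zeta\|^2$ at $p$. A hyperplane of $T_pM$ is an $(n-1)$-dimensional linear subspace. The algebraic Casorati curvature $\widehat\delta_{\mathcal C^{T,\zeta}}(n-1)$ is defined by $$[\widehat\delta_{\mathcal C^{T,\zeta}}(n-1)]_p=2\,\mathcal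 C_p^{T,\zeta}-\frac{2n-1}{2n}\sup\{\mathcal C^{T,\zeta}(\Pi_{n-1}):\Pi_{n-1}\text{ a hyperplane of }T_pM\}.$$ *)

theory Defs
  imports "HOL-Analysis.Analysis" "HOL-Library.Function_Algebras"
begin

instantiation "fun" :: (type, scaleR) scaleR
begin
definition "r *\<^sub>R f = (\<lambda>x. r *\<^sub>R f x)"
instance ..
end

instance "fun" :: (type, real_vector) real_vector
  by standard (auto simp: scaleR_fun_def fun_eq_iff algebra_simps)


text \<open>\<open>C\<^sup>k\<close> maps on an open set, by iterated directional derivatives; in finite dimension
  continuity of all directional derivatives is continuity of the derivative.\<close>

primrec Ck_on ::
  "nat \<Rightarrow> 'a::euclidean_space set \<Rightarrow> ('a \<Rightarrow> 'b::real_normed_vector) \<Rightarrow> bool" where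
  "Ck_on 0 S f \<longleftrightarrow> continuous_on S f"
| "Ck_on (Suc k) S f \<longleftrightarrow> (\<forall>x\<in>S. f differentiable (at x)) \<and>
     (\<forall>v. Ck_on k S (\<lambda>x. frechet_derivative f (at x) v))"

definition smooth_on :: "'a::euclidean_space set \<Rightarrow> ('a \<Rightarrow> 'b::real_normed_vector) \<Rightarrow> bool" where
  "smooth_on S f \<longleftrightarrow> (\<forall>k. Ck_on k S f)"


text \<open>A manifold is a Hausdorff second countable type \<open>'p\<close> with an atlas of charts
  \<open>(U, \<phi>)\<close> in \<open>'a\<close>; its dimension is \<open>DIM('a)\<close>.\<close>

type_synonym ('p, 'a) chart = "'p set \<times> ('p \<Rightarrow> 'a)"

definition is_chart :: "('p::topological_space, 'a::euclidean_space) chart \<Rightarrow> bool" where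
  "is_chart c \<longleftrightarrow> open (fst c) \<and> open (snd c ` fst c) \<and>
     homeomorphism (fst c) (snd c ` fst c) (snd c) (inv_into (fst c) (snd c))"

definition transition :: "('p, 'a) chart \<Rightarrow> ('p, 'a) chart \<Rightarrow> 'a \<Rightarrow> 'a" where
  "transition c d = snd d \<circ> inv_into (fst c) (snd c)"

definition smooth_atlas ::
  "('p::{t2_space,second_countable_topology}, 'a::euclidean_space) chart set \<Rightarrow> bool" where
  "smooth_atlas A \<longleftrightarrow> (\<forall>c\<in>A. is_chart c) \<and> (\<Union>c\<in>A. fst c) = UNIV \<and>
     (\<forall>c\<in>A. \<forall>d\<in>A. smooth_on (snd c ` (fst c \<inter> fst d)) (transition c d))"

definition smooth_fun_on ::
  "('p, 'a::euclidean_space) chart set \<Rightarrow> 'p set \<Rightarrow> ('p \<Rightarrow> real) \<Rightarrow> bool" where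
  "smooth_fun_on A W f \<longleftrightarrow>
     (\<forall>c\<in>A. smooth_on (snd c ` (fst c \<inter> W)) (f \<circ> inv_into (fst c) (snd c)))"

text \<open>A tangent vector at \<open>p\<close> is an equivalence class of pairs (chart around \<open>p\<close>, vector of
  \<open>'a\<close>) under the Jacobians of the transition maps.  Such a class contains exactly one vector
  for every chart of the atlas around \<open>p\<close>, and is represented by the resulting function on
  charts (with value 0 elsewhere).\<close>

definition tangent_space ::
  "('p, 'a::euclidean_space) chart set \<Rightarrow> 'p \<Rightarrow> (('p, 'a) chart \<Rightarrow> 'a) set" where
  "tangent_space A p = {v. (\<forall>c. \<not> (c \<in> A \<and> p \<in> fst c) \<longrightarrow> v c = 0) \<and>
     (\<forall>c\<in>A. \<forall>d\<in>A. p \<in> fst c \<and> p \<in> fst d \<longrightarrow>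
        v d = frechet_derivative (transition c d) (at (snd c p)) (v c))}"

text \<open>The tangent vector at \<open>p\<close> whose representative in the chart \<open>c\<close> around \<open>p\<close> is \<open>w\<close>;
  for \<open>w\<close> in \<open>Basis\<close> this is the coordinate vector field of \<open>c\<close>.\<close>

definition coord_vector ::
  "('p, 'a::euclidean_space) chart set \<Rightarrow> ('p, 'a) chart \<Rightarrow> 'a \<Rightarrow> 'p \<Rightarrow> ('p, 'a) chart \<Rightarrow> 'a" where
  "coord_vector A c w p =
     (\<lambda>d. if d \<in> A \<and> p \<in> fst d
          then frechet_derivative (transition c d) (at (snd c p)) w else 0)"


definition linear_on_fibre ::
  "'v::real_vector set \<Rightarrow> ('v \<Rightarrow> 'w::real_vector) \<Rightarrow> bool" where
  "linear_on_fibre V f \<longleftrightarrow>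
     (\<forall>x\<in>V. \<forall>y\<in>V. f (x + y) = f x + f y) \<and> (\<forall>r. \<forall>x\<in>V. f (r *\<^sub>R x) = r *\<^sub>R f x)"

definition bilinear_on_fibre ::
  "'v::real_vector set \<Rightarrow> ('v \<Rightarrow> 'v \<Rightarrow> 'w::real_vector) \<Rightarrow> bool" where
  "bilinear_on_fibre V f \<longleftrightarrow>
     (\<forall>y\<in>V. linear_on_fibre V (\<lambda>x. f x y)) \<and> (\<forall>x\<in>V. linear_on_fibre V (f x))"

definition inner_product_on ::
  "'v::real_vector set \<Rightarrow> ('v \<Rightarrow> 'v \<Rightarrow> real) \<Rightarrow> bool" where
  "inner_product_on V h \<longleftrightarrow> bilinear_on_fibre V h \<and>
     (\<forall>x\<in>V. \<forall>y\<in>V. h x y = h y x) \<and> (\<forall>x\<in>V. x \<noteq> 0 \<longrightarrow> h x x > 0)"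

definition orthonormal_basis ::
  "'v::real_vector set \<Rightarrow> ('v \<Rightarrow> 'v \<Rightarrow> real) \<Rightarrow> nat set \<Rightarrow> (nat \<Rightarrow> 'v) \<Rightarrow> bool" where
  "orthonormal_basis V h I e \<longleftrightarrow> span (e ` I) = V \<and>
     (\<forall>i\<in>I. \<forall>j\<in>I. h (e i) (e j) = (if i = j then 1 else 0))"

definition riemannian_manifold ::
  "('p::{t2_space,second_countable_topology}, 'a::euclidean_space) chart set \<Rightarrow>
   ('p \<Rightarrow> (('p, 'a) chart \<Rightarrow> 'a) \<Rightarrow> (('p, 'a) chart \<Rightarrow> 'a) \<Rightarrow> real) \<Rightarrow> bool" where
  "riemannian_manifold A g \<longleftrightarrow> smooth_atlas A \<and>
     (\<forall>p. inner_product_on (tangent_space A p) (g p)) \<and>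
     (\<forall>c\<in>A. \<forall>v\<in>Basis. \<forall>w\<in>Basis.
        smooth_fun_on A (fst c) (\<lambda>p. g p (coord_vector A c v p) (coord_vector A c w p)))"


text \<open>A vector bundle of rank \<open>r\<close> is a family of fibres \<open>B p\<close> (subspaces of an ambient vector
  space type without further structure, the total space being \<open>Sigma UNIV B\<close>) with local
  trivializations \<open>(U, \<phi>)\<close>, where \<open>\<phi> p\<close> maps \<open>B p\<close> onto \<open>model_fibre r\<close>, that is
  \<open>\<real>\<^sup>r\<close> (with \<open>r = 0\<close> allowed), and with smooth transition matrices.\<close>

type_synonym ('p, 'b) triv = "'p set \<times> ('p \<Rightarrow> 'b \<Rightarrow> nat \<Rightarrow> real)"

definition model_fibre :: "nat \<Rightarrow> (nat \<Rightarrow> real) set" where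
  "model_fibre r = {x. \<forall>i\<ge>r. x i = 0}"

definition triv_frame :: "('p \<Rightarrow> 'b set) \<Rightarrow> ('p, 'b) triv \<Rightarrow> nat \<Rightarrow> 'p \<Rightarrow> 'b" where
  "triv_frame B t i p = inv_into (B p) (snd t p) (\<lambda>k. if k = i then 1 else 0)"

definition vector_bundle ::
  "('p::topological_space, 'a::euclidean_space) chart set \<Rightarrow> nat \<Rightarrow>
   ('p \<Rightarrow> 'b::real_vector set) \<Rightarrow> ('p, 'b) triv set \<Rightarrow> bool" where
  "vector_bundle A r B \<Phi> \<longleftrightarrow>
     (\<forall>p. subspace (B p)) \<and> (\<Union>t\<in>\<Phi>. fst t) = UNIV \<and>
     (\<forall>t\<in>\<Phi>. open (fst t) \<and>
        (\<forall>p\<in>fst t. linear_on_fibre (B p) (snd t p) \<and> bij_betw (snd t p) (B p) (model_fibre r))) \<and>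
     (\<forall>s\<in>\<Phi>. \<forall>t\<in>\<Phi>. \<forall>i<r. \<forall>j<r.
        smooth_fun_on A (fst s \<inter> fst t) (\<lambda>p. snd t p (triv_frame B s j p) i))"

definition riemannian_vector_bundle ::
  "('p::topological_space, 'a::euclidean_space) chart set \<Rightarrow> nat \<Rightarrow>
   ('p \<Rightarrow> 'b::real_vector set) \<Rightarrow> ('p, 'b) triv set \<Rightarrow> ('p \<Rightarrow> 'b \<Rightarrow> 'b \<Rightarrow> real) \<Rightarrow> bool" where
  "riemannian_vector_bundle A r B \<Phi> gB \<longleftrightarrow> vector_bundle A r B \<Phi> \<and>
     (\<forall>p. inner_product_on (B p) (gB p)) \<and>
     (\<forall>t\<in>\<Phi>. \<forall>i<r. \<forall>j<r.
        smooth_fun_on A (fst t) (\<lambda>p. gB p (triv_frame B t i p) (triv_frame B t j p)))"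


text \<open>Tensor fields assign to each point a multilinear map on the tangent space; no regularity
  in the point is required.\<close>

definition symmetric_12_tensor_field ::
  "('p, 'a::euclidean_space) chart set \<Rightarrow> ('p \<Rightarrow> 'b::real_vector set) \<Rightarrow>
   ('p \<Rightarrow> (('p, 'a) chart \<Rightarrow> 'a) \<Rightarrow> (('p, 'a) chart \<Rightarrow> 'a) \<Rightarrow> 'b) \<Rightarrow> bool" where
  "symmetric_12_tensor_field A B \<zeta> \<longleftrightarrow>
     (\<forall>p. bilinear_on_fibre (tangent_space A p) (\<zeta> p) \<and>
        (\<forall>x\<in>tangent_space A p. \<forall>y\<in>tangent_space A p. \<zeta> p x y \<in> B p \<and> \<zeta> p x y = \<zeta> p y x))"

type_synonym ('p, 'a) tensor04 =
  "'p \<Rightarrow> (('p, 'a) chart \<Rightarrow> 'a) \<Rightarrow> (('p, 'a) chart \<Rightarrow> 'a) \<Rightarrow> (('p, 'a) chart \<Rightarrow> 'a) \<Rightarrow>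
   (('p, 'a) chart \<Rightarrow> 'a) \<Rightarrow> real"

definition tensor_field_04 ::
  "('p, 'a::euclidean_space) chart set \<Rightarrow> ('p, 'a) tensor04 \<Rightarrow> bool" where
  "tensor_field_04 A T \<longleftrightarrow>
     (\<forall>p. \<forall>x\<in>tangent_space A p. \<forall>y\<in>tangent_space A p. \<forall>z\<in>tangent_space A p.
        linear_on_fibre (tangent_space A p) (\<lambda>w. T p w x y z) \<and>
        linear_on_fibre (tangent_space A p) (\<lambda>w. T p x w y z) \<and>
        linear_on_fibre (tangent_space A p) (\<lambda>w. T p x y w z) \<and>
        linear_on_fibre (tangent_space A p) (\<lambda>w. T p x y z w))"

definition curvature_like ::
  "('p, 'a::euclidean_space) chart set \<Rightarrow> ('p, 'a) tensor04 \<Rightarrow> bool" where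
  "curvature_like A T \<longleftrightarrow> tensor_field_04 A T \<and>
     (\<forall>p. \<forall>x\<in>tangent_space A p. \<forall>y\<in>tangent_space A p.
          \<forall>z\<in>tangent_space A p. \<forall>w\<in>tangent_space A p.
        T p x y z w = - T p y x z w \<and>
        T p x y z w = T p z w x y \<and>
        T p x y z w + T p y z x w + T p z x y w = 0)"

definition algebraic_gauss_equation ::
  "('p, 'a::euclidean_space) chart set \<Rightarrow> ('p \<Rightarrow> 'b \<Rightarrow> 'b \<Rightarrow> real) \<Rightarrow>
   ('p \<Rightarrow> (('p, 'a) chart \<Rightarrow> 'a) \<Rightarrow> (('p, 'a) chart \<Rightarrow> 'a) \<Rightarrow> 'b) \<Rightarrow> ('p, 'a) tensor04 \<Rightarrow> bool" where
  "algebraic_gauss_equation A gB \<zeta> T \<longleftrightarrow>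
     (\<forall>p. \<forall>x\<in>tangent_space A p. \<forall>y\<in>tangent_space A p.
          \<forall>z\<in>tangent_space A p. \<forall>w\<in>tangent_space A p.
        T p x y z w = gB p (\<zeta> p x w) (\<zeta> p y z) - gB p (\<zeta> p x z) (\<zeta> p y w))"


text \<open>The sums below do not depend on the orthonormal bases picked by \<open>SOME\<close>.\<close>

definition scalar_curvature ::
  "('p, 'a::euclidean_space) chart set \<Rightarrow>
   ('p \<Rightarrow> (('p, 'a) chart \<Rightarrow> 'a) \<Rightarrow> (('p, 'a) chart \<Rightarrow> 'a) \<Rightarrow> real) \<Rightarrow>
   ('p, 'a) tensor04 \<Rightarrow> 'p \<Rightarrow> real" where
  "scalar_curvature A g T p =
     (let e = (SOME e. orthonormal_basis (tangent_space A p) (g p) {1..DIM('a)} e)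
      in \<Sum>j=1..DIM('a). \<Sum>i=1..<j. T p (e i) (e j) (e j) (e i))"

definition normalized_scalar_curvature ::
  "('p, 'a::euclidean_space) chart set \<Rightarrow>
   ('p \<Rightarrow> (('p, 'a) chart \<Rightarrow> 'a) \<Rightarrow> (('p, 'a) chart \<Rightarrow> 'a) \<Rightarrow> real) \<Rightarrow>
   ('p, 'a) tensor04 \<Rightarrow> 'p \<Rightarrow> real" where
  "normalized_scalar_curvature A g T p =
     2 / (real DIM('a) * (real DIM('a) - 1)) * scalar_curvature A g T p"

definition casorati ::
  "('p \<Rightarrow> (('p, 'a) chart \<Rightarrow> 'a) \<Rightarrow> (('p, 'a) chart \<Rightarrow> 'a::euclidean_space) \<Rightarrow> real) \<Rightarrow>
   ('p \<Rightarrow> 'b::real_vector set) \<Rightarrow> ('p \<Rightarrow> 'b \<Rightarrow> 'b \<Rightarrow> real) \<Rightarrow>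
   ('p \<Rightarrow> (('p, 'a) chart \<Rightarrow> 'a) \<Rightarrow> (('p, 'a) chart \<Rightarrow> 'a) \<Rightarrow> 'b) \<Rightarrow>
   'p \<Rightarrow> (('p, 'a) chart \<Rightarrow> 'a) set \<Rightarrow> real" where
  "casorati g B gB \<zeta> p P =
     (let n = DIM('a); m = n + dim (B p); k = dim P;
          e = (SOME e. orthonormal_basis P (g p) {1..k} e);
          f = (SOME f. orthonormal_basis (B p) (gB p) {n+1..m} f)
      in 1 / real k * (\<Sum>\<alpha>=n+1..m. \<Sum>i=1..k. \<Sum>j=1..k. (gB p (\<zeta> p (e i) (e j)) (f \<alpha>))\<^sup>2))"

definition hyperplane ::
  "('p, 'a::euclidean_space) chart set \<Rightarrow> 'p \<Rightarrow> (('p, 'a) chart \<Rightarrow> 'a) set \<Rightarrow> bool" where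
  "hyperplane A p P \<longleftrightarrow> subspace P \<and> P \<subseteq> tangent_space A p \<and> dim P = DIM('a) - 1"

definition sup_casorati ::
  "('p, 'a::euclidean_space) chart set \<Rightarrow>
   ('p \<Rightarrow> (('p, 'a) chart \<Rightarrow> 'a) \<Rightarrow> (('p, 'a) chart \<Rightarrow> 'a) \<Rightarrow> real) \<Rightarrow>
   ('p \<Rightarrow> 'b::real_vector set) \<Rightarrow> ('p \<Rightarrow> 'b \<Rightarrow> 'b \<Rightarrow> real) \<Rightarrow>
   ('p \<Rightarrow> (('p, 'a) chart \<Rightarrow> 'a) \<Rightarrow> (('p, 'a) chart \<Rightarrow> 'a) \<Rightarrow> 'b) \<Rightarrow> 'p \<Rightarrow> real" where
  "sup_casorati A g B gB \<zeta> p = Sup {casorati g B gB \<zeta> p P | P. hyperplane A p P}"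

definition delta_hat_casorati ::
  "('p, 'a::euclidean_space) chart set \<Rightarrow>
   ('p \<Rightarrow> (('p, 'a) chart \<Rightarrow> 'a) \<Rightarrow> (('p, 'a) chart \<Rightarrow> 'a) \<Rightarrow> real) \<Rightarrow>
   ('p \<Rightarrow> 'b::real_vector set) \<Rightarrow> ('p \<Rightarrow> 'b \<Rightarrow> 'b \<Rightarrow> real) \<Rightarrow>
   ('p \<Rightarrow> (('p, 'a) chart \<Rightarrow> 'a) \<Rightarrow> (('p, 'a) chart \<Rightarrow> 'a) \<Rightarrow> 'b) \<Rightarrow> 'p \<Rightarrow> real" where
  "delta_hat_casorati A g B gB \<zeta> p =
     2 * casorati g B gB \<zeta> p (tangent_space A p) -
     (2 * real DIM('a) - 1) / (2 * real DIM('a)) * sup_casorati A g B gB \<zeta> p"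

end

theory Submission
  imports Defs
begin

text \<open>For an orthonormal basis \<open>e\<close> of the tangent space with \<open>\<Pi>\<close> spanned by the first
  \<open>n - 1\<close> vectors, the Gauss equation gives \<open>2\<tau> = \<parallel>trace \<zeta>\<parallel>\<^sup>2 - \<parallel>\<zeta>\<parallel>\<^sup>2\<close>.  Hence, up to the
  factor \<open>n(n-1)\<close>, the difference \<open>2C - (2n-1)/(2n) C(\<Pi>) - \<tau>\<^sub>N\<^sub>o\<^sub>r\<close> is, for each normal
  direction, a nonnegative combination of squares of the off-diagonal entries plus
  \<open>\<Sum>w\<^sub>i h\<^sub>i\<^sub>i\<^sup>2 - (\<Sum>h\<^sub>i\<^sub>i)\<^sup>2\<close> with \<open>w\<^sub>i = (2n-1)/2\<close> for \<open>i < n\<close> and \<open>w\<^sub>n = 2n-1\<close>.  As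
  \<open>\<Sum>1/w\<^sub>i = 1\<close>, the latter is nonnegative by Cauchy-Schwarz and vanishes iff all \<open>w\<^sub>i h\<^sub>i\<^sub>i\<close>
  agree, that is, \<open>h\<^sub>i\<^sub>i = 2 h\<^sub>n\<^sub>n\<close> for \<open>i < n\<close>.  So the difference is nonnegative for every
  hyperplane, in particular in the supremum; and a basis of the special shape makes it vanish,
  which forces \<open>\<Pi>\<close> to attain the supremum.\<close>

subsection \<open>Orthonormal bases of subspaces\<close>

lemma linear_on_fibre_sum:
  assumes "subspace V" "linear_on_fibre V f" "\<And>i. i \<in> I \<Longrightarrow> x i \<in> V"
  shows "f (\<Sum>i\<in>I. u i *\<^sub>R x i) = (\<Sum>i\<in>I. u i *\<^sub>R f (x i))"
proof -
  have "f 0 = 0"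
    using assms(2) subspace_0[OF assms(1)] unfolding linear_on_fibre_def by (metis scaleR_zero_left)
  then show ?thesis
    using assms(3)
  proof (induction I rule: infinite_finite_induct)
    case (insert a I)
    then show ?case
      using assms(1,2)
      by (simp add: linear_on_fibre_def subspace_scale subspace_sum)
  qed auto
qed

lemma bilinear_on_fibre_sum:
  assumes "subspace V" "bilinear_on_fibre V f" "\<And>i. i \<in> I \<Longrightarrow> x i \<in> V" "\<And>j. j \<in> J \<Longrightarrow> y j \<in> V"
  shows "f (\<Sum>i\<in>I. u i *\<^sub>R x i) (\<Sum>j\<in>J. v j *\<^sub>R y j) =
    (\<Sum>i\<in>I. \<Sum>j\<in>J. (u i * v j) *\<^sub>R f (x i) (y j))"
proof -
  have "(\<Sum>j\<in>J. v j *\<^sub>R y j) \<in> V"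
    using assms by (intro subspace_sum subspace_scale) auto
  then have "f (\<Sum>i\<in>I. u i *\<^sub>R x i) (\<Sum>j\<in>J. v j *\<^sub>R y j) =
      (\<Sum>i\<in>I. u i *\<^sub>R f (x i) (\<Sum>j\<in>J. v j *\<^sub>R y j))"
    using assms by (intro linear_on_fibre_sum[where f="\<lambda>x. f x _"]) (auto simp: bilinear_on_fibre_def)
  also have "\<dots> = (\<Sum>i\<in>I. \<Sum>j\<in>J. (u i * v j) *\<^sub>R f (x i) (y j))"
  proof (intro sum.cong refl)
    fix i assume "i \<in> I"
    then have "f (x i) (\<Sum>j\<in>J. v j *\<^sub>R y j) = (\<Sum>j\<in>J. v j *\<^sub>R f (x i) (y j))"
      using assms by (intro linear_on_fibre_sum) (auto simp: bilinear_on_fibre_def)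
    then show "u i *\<^sub>R f (x i) (\<Sum>j\<in>J. v j *\<^sub>R y j) = (\<Sum>j\<in>J. (u i * v j) *\<^sub>R f (x i) (y j))"
      by (simp add: scaleR_sum_right)
  qed
  finally show ?thesis .
qed

lemma inner_product_on_subset:
  assumes "inner_product_on V h" "U \<subseteq> V"
  shows "inner_product_on U h"
  using assms unfolding inner_product_on_def bilinear_on_fibre_def linear_on_fibre_def
  by (meson subsetD)

lemma bilinear_on_fibre_subset:
  assumes "bilinear_on_fibre V h" "U \<subseteq> V"
  shows "bilinear_on_fibre U h"
  using assms unfolding bilinear_on_fibre_def linear_on_fibre_def
  by (meson subsetD)

text \<open>Tangent spaces, hyperplanes and bundle fibres are only subspaces of larger types, and
  their inner products depend on the point. All of the Euclidean linear algebra is therefore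
  relative to a carrier \<open>V\<close>, with \<open>h\<close> constrained on \<open>V\<close>
  alone.\<close>

locale inner_product_fibre =
  fixes V :: "'v::real_vector set" and h :: "'v \<Rightarrow> 'v \<Rightarrow> real"
  assumes subspace: "subspace V" and inner_product: "inner_product_on V h"
begin

lemma bilinear: "bilinear_on_fibre V h"
  using inner_product by (simp add: inner_product_on_def)

lemma commute: "x \<in> V \<Longrightarrow> y \<in> V \<Longrightarrow> h x y = h y x"
  using inner_product by (simp add: inner_product_on_def)

lemma positive: "x \<in> V \<Longrightarrow> x \<noteq> 0 \<Longrightarrow> h x x > 0"
  using inner_product by (simp add: inner_product_on_def)

lemma linear_left: "y \<in> V \<Longrightarrow> linear_on_fibre V (\<lambda>x. h x y)"
  using bilinear by (simp add: bilinear_on_fibre_def)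

lemma linear_right: "x \<in> V \<Longrightarrow> linear_on_fibre V (h x)"
  using bilinear by (simp add: bilinear_on_fibre_def)

lemma orthonormal_basis_in: "orthonormal_basis V h I e \<Longrightarrow> i \<in> I \<Longrightarrow> e i \<in> V"
  unfolding orthonormal_basis_def by (metis image_eqI span_base)

lemma orthonormal_expansion:
  assumes e: "orthonormal_basis V h I e" and "finite I" and "x \<in> V"
  shows "(\<Sum>i\<in>I. h x (e i) *\<^sub>R e i) = x"
proof -
  have eV: "e i \<in> V" if "i \<in> I" for i
    using orthonormal_basis_in[OF e that] .
  let ?E = "\<lambda>x. \<Sum>i\<in>I. h x (e i) *\<^sub>R e i"
  have add: "?E (x + y) = ?E x + ?E y" if "x \<in> V" "y \<in> V" for x y
    unfolding sum.distrib[symmetric]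
    by (intro sum.cong refl) (use that eV linear_left in \<open>simp add: linear_on_fibre_def scaleR_add_left\<close>)
  have scale: "?E (r *\<^sub>R x) = r *\<^sub>R ?E x" if "x \<in> V" for x r
    unfolding scaleR_sum_right
    by (intro sum.cong refl) (use that eV linear_left in \<open>simp add: linear_on_fibre_def\<close>)
  have zero: "?E 0 = 0"
    using scale[OF subspace_0[OF subspace], of 0] by simp
  have "subspace {x \<in> V. ?E x = x}"
    using subspace add scale zero by (auto simp: subspace_def)
  moreover have "?E (e j) = e j" if "j \<in> I" for j
  proof -
    have "?E (e j) = (\<Sum>i\<in>I. if i = j then e i else 0)"
      by (intro sum.cong refl) (use that e in \<open>auto simp: orthonormal_basis_def\<close>)
    then show ?thesis
      using that \<open>finite I\<close> by simp
  qed
  ultimately have "span (e ` I) \<subseteq> {x \<in> V. ?E x = x}"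
    using eV by (intro span_minimal) auto
  then show ?thesis
    using e \<open>x \<in> V\<close> by (auto simp: orthonormal_basis_def)
qed

lemma parseval:
  assumes e: "orthonormal_basis V h I e" and "finite I" and x: "x \<in> V" and y: "y \<in> V"
  shows "(\<Sum>i\<in>I. h x (e i) * h y (e i)) = h x y"
proof -
  have "h x (\<Sum>i\<in>I. h y (e i) *\<^sub>R e i) = (\<Sum>i\<in>I. h y (e i) *\<^sub>R h x (e i))"
    using linear_on_fibre_sum[OF subspace linear_right[OF x]] orthonormal_basis_in[OF e] .
  then show ?thesis
    using orthonormal_expansion[OF e \<open>finite I\<close> y] by (simp add: mult.commute)
qed

text \<open>Expanding each \<open>e i\<close> in \<open>e'\<close> and summing over \<open>i\<close>
  first leaves the entries of \<open>q\<close> in \<open>e'\<close> weighted by products of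
  change-of-basis coefficients, which Parseval evaluates. This is what makes the quantities defined
  through \<open>SOME\<close> bases computable in any basis.\<close>

lemma trace_independent:
  assumes e: "orthonormal_basis V h I e" "finite I"
    and e': "orthonormal_basis V h J e'" "finite J"
    and q: "bilinear_on_fibre V q"
  shows "(\<Sum>i\<in>I. q (e i) (e i)) = (\<Sum>j\<in>J. q (e' j) (e' j))"
proof -
  note eV = orthonormal_basis_in[OF e(1)] orthonormal_basis_in[OF e'(1)]
  have "(\<Sum>i\<in>I. q (e i) (e i)) =
      (\<Sum>i\<in>I. \<Sum>j\<in>J. \<Sum>k\<in>J. (h (e i) (e' j) * h (e i) (e' k)) *\<^sub>R q (e' j) (e' k))"
  proof (intro sum.cong refl)
    fix i assume "i \<in> I"
    have "q (\<Sum>j\<in>J. h (e i) (e' j) *\<^sub>R e' j) (\<Sum>k\<in>J. h (e i) (e' k) *\<^sub>R e' k) =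
        (\<Sum>j\<in>J. \<Sum>k\<in>J. (h (e i) (e' j) * h (e i) (e' k)) *\<^sub>R q (e' j) (e' k))"
      using bilinear_on_fibre_sum[OF subspace q eV(2) eV(2)] .
    then show "q (e i) (e i) =
        (\<Sum>j\<in>J. \<Sum>k\<in>J. (h (e i) (e' j) * h (e i) (e' k)) *\<^sub>R q (e' j) (e' k))"
      unfolding orthonormal_expansion[OF e' eV(1)[OF \<open>i \<in> I\<close>]] .
  qed
  also have "\<dots> =
      (\<Sum>j\<in>J. \<Sum>k\<in>J. \<Sum>i\<in>I. (h (e i) (e' j) * h (e i) (e' k)) *\<^sub>R q (e' j) (e' k))"
    by (subst sum.swap) (intro sum.cong refl sum.swap)
  also have "\<dots> = (\<Sum>j\<in>J. \<Sum>k\<in>J. if k = j then q (e' j) (e' k) else 0)"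
  proof (intro sum.cong refl)
    fix j k assume jk: "j \<in> J" "k \<in> J"
    \<comment> \<open>The columns of the change-of-basis matrix are orthonormal: this is Parseval
      for \<open>e' j\<close> and \<open>e' k\<close> with respect to \<open>e\<close>.\<close>
    have "(\<Sum>i\<in>I. h (e i) (e' j) * h (e i) (e' k)) = (\<Sum>i\<in>I. h (e' j) (e i) * h (e' k) (e i))"
      using eV jk by (intro sum.cong refl) (simp add: commute)
    also have "\<dots> = (if j = k then 1 else 0)"
      using parseval[OF e] eV(2) jk e'(1) by (simp add: orthonormal_basis_def)
    finally show "(\<Sum>i\<in>I. (h (e i) (e' j) * h (e i) (e' k)) *\<^sub>R q (e' j) (e' k)) =
        (if k = j then q (e' j) (e' k) else 0)"
      unfolding scaleR_sum_left[symmetric] by simp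
  qed
  also have "\<dots> = (\<Sum>j\<in>J. q (e' j) (e' j))"
    using \<open>finite J\<close> by simp
  finally show ?thesis .
qed

text \<open>Pairing a linear relation with \<open>e j\<close> isolates the coefficient of
  \<open>e j\<close>.\<close>

lemma orthonormal_inj_independent:
  assumes e: "orthonormal_basis V h I e" and "finite I"
  shows "inj_on e I" "independent (e ` I)" "dim V = card I"
proof -
  note eV = orthonormal_basis_in[OF e]
  show inj: "inj_on e I"
  proof (rule inj_onI)
    fix i j assume "i \<in> I" "j \<in> I" "e i = e j"
    then show "i = j"
      using e unfolding orthonormal_basis_def by (metis zero_neq_one)
  qed
  show ind: "independent (e ` I)"
  proof (rule independent_if_scalars_zero)
    fix u x assume "(\<Sum>y\<in>e ` I. u y *\<^sub>R y) = 0" and "x \<in> e ` I"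
    then obtain j where j: "j \<in> I" "x = e j" and
      z: "(\<Sum>i\<in>I. u (e i) *\<^sub>R e i) = 0"
      using inj by (auto simp: sum.reindex)
    have "h 0 (e j) = 0"
      using linear_left[OF eV[OF j(1)]] subspace_0[OF subspace]
      unfolding linear_on_fibre_def by (metis scaleR_zero_left)
    then have "0 = (\<Sum>i\<in>I. u (e i) *\<^sub>R h (e i) (e j))"
      using linear_on_fibre_sum[OF subspace linear_left[OF eV[OF j(1)]], of I e "\<lambda>i. u (e i)"] z eV
      by simp
    also have "\<dots> = (\<Sum>i\<in>I. if i = j then u (e i) else 0)"
      by (intro sum.cong refl) (use e j in \<open>auto simp: orthonormal_basis_def\<close>)
    finally show "u x = 0"
      using j \<open>finite I\<close> by simp
  qed (use \<open>finite I\<close> in auto)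
  have "span (e ` I) = V"
    using e by (simp add: orthonormal_basis_def)
  then show "dim V = card I"
    using ind inj by (metis dim_span_eq_card_independent card_image)
qed

text \<open>One Gram-Schmidt step: subtract from \<open>x\<close> its projection \<open>z\<close>
  onto \<open>U\<close>, normalize, and store the result at index \<open>Suc k\<close>. The old
  vectors stay in place, so a basis of a hyperplane can later be completed without changing
  it.\<close>

lemma orthonormal_basis_extend_Suc:
  assumes e: "orthonormal_basis U h {1..k} e" and "U \<subseteq> V" and x: "x \<in> V" "x \<notin> U"
  shows "\<exists>e'. (\<forall>i\<in>{1..k}. e' i = e i) \<and> orthonormal_basis (span (insert x U)) h {1..Suc k} e'"
proof -
  have U: "subspace U"
    using e subspace_span unfolding orthonormal_basis_def by metis
  interpret U: inner_product_fibre U h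
    using U inner_product_on_subset[OF inner_product \<open>U \<subseteq> V\<close>] by unfold_locales
  note eU = U.orthonormal_basis_in[OF e]
  define z where "z = (\<Sum>i\<in>{1..k}. h x (e i) *\<^sub>R e i)"
  define y where "y = x - z"
  have z: "z \<in> U"
    unfolding z_def using U eU by (intro subspace_sum subspace_scale) auto
  have yV: "y \<in> V" and y0: "y \<noteq> 0"
    using x z \<open>U \<subseteq> V\<close> subspace by (auto simp: y_def subspace_diff)
  have he: "h (u + c *\<^sub>R v) w = h u w + c * h v w" if "u \<in> V" "v \<in> V" "w \<in> V" for u v w c
    using linear_left[of w] that subspace_scale[OF subspace]
    by (simp add: linear_on_fibre_def)
  have orth: "h y (e j) = 0" if j: "j \<in> {1..k}" for j
  proof -
    have "h z (e j) = (\<Sum>i\<in>{1..k}. h x (e i) *\<^sub>R h (e i) (e j))"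
      unfolding z_def using linear_on_fibre_sum[OF U U.linear_left[OF eU[OF j]]] eU .
    also have "\<dots> = (\<Sum>i\<in>{1..k}. if i = j then h x (e i) else 0)"
      by (intro sum.cong refl) (use e j in \<open>auto simp: orthonormal_basis_def\<close>)
    finally show ?thesis
      using he[of x z "e j" "-1"] x z eU[OF j] j \<open>U \<subseteq> V\<close> by (auto simp: y_def)
  qed
  \<comment> \<open>The normalizing factor. Here \<open>h y y > 0\<close>, because
    \<open>y = 0\<close> would put \<open>x = z\<close> into \<open>U\<close>.\<close>
  define c where "c = 1 / sqrt (h y y)"
  have c: "c \<noteq> 0" "c * c * h y y = 1"
    using positive[OF yV y0] by (auto simp: c_def)
  have cy: "c *\<^sub>R y \<in> V"
    using yV subspace subspace_scale by blast
  have h0: "h (0 + d *\<^sub>R u) w = d * h u w" if "u \<in> V" "w \<in> V" for u w d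
    using linear_left[of w] that by (simp add: linear_on_fibre_def)
  have c1: "h (c *\<^sub>R y) (c *\<^sub>R y) = 1"
    using h0[OF yV cy, of c] h0[OF yV yV, of c] commute[OF yV cy] c(2) by simp
  have c2: "h (c *\<^sub>R y) (e j) = 0" "h (e j) (c *\<^sub>R y) = 0" if "j \<in> {1..k}" for j
    using h0[of y "e j" c] yV cy eU[OF that] \<open>U \<subseteq> V\<close> orth[OF that] commute[of "e j" "c *\<^sub>R y"]
    by auto
  define e' where "e' = e(Suc k := c *\<^sub>R y)"
  have img: "e' ` {1..Suc k} = insert (c *\<^sub>R y) (e ` {1..k})"
    by (auto simp: e'_def atLeastAtMostSuc_conv)
  have sU: "span (e ` {1..k}) = U"
    using e by (simp add: orthonormal_basis_def)
  have "span (e' ` {1..Suc k}) = span (insert x U)"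
  proof
    have "c *\<^sub>R y \<in> span (insert x U)"
      unfolding y_def using z by (intro span_scale span_diff) (auto intro: span_base)
    then show "span (e' ` {1..Suc k}) \<subseteq> span (insert x U)"
      unfolding img using eU by (intro span_minimal) (auto intro: span_base)
    have U': "U \<subseteq> span (e' ` {1..Suc k})"
      unfolding img sU[symmetric] by (intro span_mono) auto
    \<comment> \<open>Undoing the normalization recovers \<open>y\<close>, hence
      \<open>x = y + z\<close>, from the new basis.\<close>
    have "y = (1 / c) *\<^sub>R (c *\<^sub>R y)"
      using c by simp
    then have "y \<in> span (e' ` {1..Suc k})"
      unfolding img by (metis insertI1 span_base span_scale)
    then have "y + z \<in> span (e' ` {1..Suc k})"
      using U' z by (intro span_add) auto
    then show "span (insert x U) \<subseteq> span (e' ` {1..Suc k})"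
      using U' by (intro span_minimal) (auto simp: y_def)
  qed
  moreover have "h (e' i) (e' j) = (if i = j then 1 else 0)"
    if "i \<in> {1..Suc k}" "j \<in> {1..Suc k}" for i j
    using that c1 c2 e unfolding e'_def orthonormal_basis_def
    by (auto simp: atLeastAtMostSuc_conv)
  ultimately show ?thesis
    by (intro exI[of _ e']) (auto simp: orthonormal_basis_def e'_def)
qed

text \<open>Gram-Schmidt steps are repeated while \<open>U\<close> is a proper subspace. The finite
  spanning set \<open>C\<close> bounds the number of steps.\<close>

lemma orthonormal_basis_extend:
  assumes "orthonormal_basis U h {1..k} e" "U \<subseteq> V" "finite C" "span C = V"
  shows "\<exists>e'. (\<forall>i\<in>{1..k}. e' i = e i) \<and> orthonormal_basis V h {1..dim V} e'"
  using assms
proof (induction "card C - k" arbitrary: U k e rule: less_induct)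
  case less
  show ?case
  proof (cases "U = V")
    case True
    then have "dim V = k"
      using orthonormal_inj_independent(3) less.prems(1) by fastforce
    then show ?thesis
      using less.prems(1) True by blast
  next
    case False
    then obtain x where x: "x \<in> V" "x \<notin> U"
      using less.prems(2) by blast
    obtain e1 where e1: "\<forall>i\<in>{1..k}. e1 i = e i"
      "orthonormal_basis (span (insert x U)) h {1..Suc k} e1" (is "orthonormal_basis ?U _ _ _")
      using orthonormal_basis_extend_Suc[OF less.prems(1,2) x] by blast
    have U': "?U \<subseteq> V"
      using subspace x less.prems(2) by (intro span_minimal) auto
    interpret U': inner_product_fibre ?U h
      using inner_product_on_subset[OF inner_product U'] by unfold_locales auto
    have "e1 ` {1..Suc k} \<subseteq> span C"
      using U'.orthonormal_basis_in[OF e1(2)] U' less.prems(4) by blast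
    \<comment> \<open>The enlarged system is independent inside \<open>span C\<close>, so
      \<open>Suc k \<le> card C\<close>. This makes the truncated difference
      \<open>card C - k\<close> strictly decrease.\<close>
    then have "card (e1 ` {1..Suc k}) \<le> card C"
      using independent_span_bound[OF less.prems(3)] U'.orthonormal_inj_independent[OF e1(2)] by simp
    then have "Suc k \<le> card C"
      using U'.orthonormal_inj_independent(1)[OF e1(2)] by (simp add: card_image)
    then have "\<exists>e'. (\<forall>i\<in>{1..Suc k}. e' i = e1 i) \<and> orthonormal_basis V h {1..dim V} e'"
      by (intro less.hyps[OF _ e1(2) U' less.prems(3,4)]) auto
    then obtain e' where "\<forall>i\<in>{1..Suc k}. e' i = e1 i" "orthonormal_basis V h {1..dim V} e'"
      by blast
    then show ?thesis
      using e1(1) by (intro exI[of _ e']) auto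
  qed
qed

lemma orthonormal_basis_exists:
  assumes "finite C" "span C = V"
  shows "\<exists>e. orthonormal_basis V h {1..dim V} e"
proof -
  \<comment> \<open>The extension starts from the empty basis of the zero subspace.\<close>
  have "orthonormal_basis {0} h {1..0} (\<lambda>_. 0)"
    by (simp add: orthonormal_basis_def)
  then show ?thesis
    using orthonormal_basis_extend[OF _ _ assms] subspace_0[OF subspace] by blast
qed

end

text \<open>An infinite basis has \<open>card\<close> equal to 0, so a positive \<open>dim\<close>
  already certifies that a basis is finite.\<close>

lemma finite_spanning_set_of_dim_pos:
  fixes V :: "'v::real_vector set"
  assumes "subspace V" "dim V > 0"
  obtains C where "finite C" "span C = V"
proof -
  obtain C where "C \<subseteq> V" "independent C" "V \<subseteq> span C" "card C = dim V"
    using basis_exists by blast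
  then have "finite C" "span C = V"
    using assms card_gt_0_iff[of C] span_minimal[of C V] by auto
  then show thesis
    using that by blast
qed


subsection \<open>The quadratic form of a hyperplane\<close>

text \<open>For the components \<open>x\<close> of \<open>\<zeta>\<close> in one normal direction: \<open>n(n-1)\<close> times their contribution
  to \<open>2C - (2n-1)/(2n) C(\<Pi>) - \<tau>\<^sub>N\<^sub>o\<^sub>r\<close>.\<close>

definition casorati_defect :: "nat \<Rightarrow> (nat \<Rightarrow> nat \<Rightarrow> real) \<Rightarrow> real" where
  "casorati_defect n x =
     (2 * real n - 1) * (\<Sum>i=1..n. \<Sum>j=1..n. (x i j)\<^sup>2)
     - (2 * real n - 1) / 2 * (\<Sum>i=1..n-1. \<Sum>j=1..n-1. (x i j)\<^sup>2)
     - (\<Sum>i=1..n. x i i)\<^sup>2"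

text \<open>Expanding the squares on the right gives cross terms \<open>- 2 * s * s\<close> and, as
  the reciprocals of the weights sum to 1, a last term \<open>s * s\<close>. Writing the
  Cauchy-Schwarz deficit as a sum of squares yields both its sign and its equality case.\<close>

lemma sum_weighted_squares_minus_square:
  fixes w y :: "'i \<Rightarrow> real"
  assumes "\<And>i. i \<in> I \<Longrightarrow> w i > 0" and "(\<Sum>i\<in>I. 1 / w i) = 1"
  shows "(\<Sum>i\<in>I. w i * (y i)\<^sup>2) - (\<Sum>i\<in>I. y i)\<^sup>2 = (\<Sum>i\<in>I. w i * (y i - (\<Sum>i\<in>I. y i) / w i)\<^sup>2)"
proof -
  define s where "s = (\<Sum>i\<in>I. y i)"
  have "(\<Sum>i\<in>I. w i * (y i - s / w i)\<^sup>2) = (\<Sum>i\<in>I. w i * (y i)\<^sup>2 - 2 * s * y i + s\<^sup>2 * (1 / w i))"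
    using assms(1) by (intro sum.cong refl) (force simp: power2_eq_square field_simps)
  also have "\<dots> = (\<Sum>i\<in>I. w i * (y i)\<^sup>2) - 2 * s * s + s\<^sup>2 * 1"
    unfolding sum.distrib sum_subtractf sum_distrib_left[symmetric] assms(2) s_def ..
  finally show ?thesis
    unfolding s_def[symmetric] by (simp add: power2_eq_square)
qed

text \<open>The square array splits into the leading block, the last row and column, and the corner.
  Off-diagonal entries of the block keep the coefficient \<open>c - c / 2\<close>, those of the last
  row and column keep \<open>c\<close>. The diagonal entries together with the squared trace are
  handled by the weighted identity.\<close>

lemma casorati_defect_sum_of_squares:
  fixes x :: "nat \<Rightarrow> nat \<Rightarrow> real"
  assumes "n \<ge> 1"
  defines "c \<equiv> 2 * real n - 1" and "s \<equiv> \<Sum>i=1..n. x i i"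
  shows "casorati_defect n x =
    c / 2 * (\<Sum>i=1..n-1. \<Sum>j\<in>{1..n-1}-{i}. (x i j)\<^sup>2)
    + c * (\<Sum>i=1..n-1. (x i n)\<^sup>2 + (x n i)\<^sup>2)
    + c / 2 * (\<Sum>i=1..n-1. (x i i - 2 * s / c)\<^sup>2) + c * (x n n - s / c)\<^sup>2"
proof -
  obtain k where n: "n = Suc k"
    using assms(1) by (cases n) auto
  have c: "c > 0" "c = 2 * real k + 1"
    by (auto simp: c_def n)
  \<comment> \<open>These weights are the coefficients left on the diagonal. With
    \<open>k = n - 1\<close> their reciprocals sum to \<open>(2 * k + 1) / c = 1\<close>.\<close>
  define w where "w i = (if i = n then c else c / 2)" for i :: nat
  \<comment> \<open>Indices up to \<open>k\<close> never meet the exceptional index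
    \<open>n\<close>. The free \<open>F\<close> serves the sum of reciprocals and both sides of the
    weighted identity.\<close>
  have wk: "(\<Sum>i=1..k. F i (w i)) = (\<Sum>i=1..k. F i (c / 2))" for F :: "nat \<Rightarrow> real \<Rightarrow> real"
    by (intro sum.cong refl) (auto simp: w_def n)
  have "(\<Sum>i=1..n. 1 / w i) = real k * (2 / c) + 1 / c"
    using wk[of "\<lambda>_ v. 1 / v"] by (simp add: n w_def)
  also have "\<dots> = 1"
    using c by (simp add: field_simps)
  finally have "(\<Sum>i=1..n. w i * (x i i)\<^sup>2) - s\<^sup>2 = (\<Sum>i=1..n. w i * (x i i - s / w i)\<^sup>2)"
    unfolding s_def using c by (intro sum_weighted_squares_minus_square) (auto simp: w_def)
  then have diag: "c / 2 * (\<Sum>i=1..k. (x i i)\<^sup>2) + c * (x n n)\<^sup>2 - s\<^sup>2 =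
      c / 2 * (\<Sum>i=1..k. (x i i - 2 * s / c)\<^sup>2) + c * (x n n - s / c)\<^sup>2"
    using wk[of "\<lambda>i v. v * (x i i)\<^sup>2"] wk[of "\<lambda>i v. v * (x i i - s / v)\<^sup>2"]
    by (simp add: n w_def sum_distrib_left mult.commute)
  have block: "(\<Sum>i=1..k. \<Sum>j=1..k. (x i j)\<^sup>2) =
      (\<Sum>i=1..k. (x i i)\<^sup>2) + (\<Sum>i=1..k. \<Sum>j\<in>{1..k}-{i}. (x i j)\<^sup>2)"
    unfolding sum.distrib[symmetric] by (intro sum.cong refl sum.remove) auto
  have full: "(\<Sum>i=1..n. \<Sum>j=1..n. (x i j)\<^sup>2) =
      (\<Sum>i=1..k. \<Sum>j=1..k. (x i j)\<^sup>2) + (\<Sum>i=1..k. (x i n)\<^sup>2 + (x n i)\<^sup>2) + (x n n)\<^sup>2"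
    by (simp add: n sum.distrib)
  show ?thesis
    unfolding casorati_defect_def c_def[symmetric] s_def[symmetric] full
    using diag block by (simp add: n algebra_simps)
qed

lemma casorati_defect_nonneg: "n \<ge> 1 \<Longrightarrow> casorati_defect n x \<ge> 0"
  unfolding casorati_defect_sum_of_squares
  by (intro add_nonneg_nonneg mult_nonneg_nonneg sum_nonneg) auto

text \<open>A sum of nonnegative terms vanishes only termwise. The first two groups kill the
  off-diagonal entries; the last two say \<open>x i i = 2 * s / c\<close> and
  \<open>x n n = s / c\<close>, from which the trace \<open>s\<close> has to be eliminated.\<close>

lemma casorati_defect_eq_0_iff:
  assumes "n \<ge> 1"
  shows "casorati_defect n x = 0 \<longleftrightarrow>
    (\<forall>i\<in>{1..n}. \<forall>j\<in>{1..n}. i \<noteq> j \<longrightarrow> x i j = 0) \<and> (\<forall>i\<in>{1..n-1}. x i i = 2 * x n n)"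
    (is "_ \<longleftrightarrow> ?off \<and> ?diag")
proof -
  define c s where "c = 2 * real n - 1" and "s = (\<Sum>i=1..n. x i i)"
  have c: "c > 0"
    using assms by (simp add: c_def)
  let ?a = "\<Sum>i=1..n-1. \<Sum>j\<in>{1..n-1}-{i}. (x i j)\<^sup>2"
  let ?b = "\<Sum>i=1..n-1. (x i n)\<^sup>2 + (x n i)\<^sup>2"
  let ?d = "\<Sum>i=1..n-1. (x i i - 2 * s / c)\<^sup>2"
  have nonneg: "?a \<ge> 0" "?b \<ge> 0" "?d \<ge> 0"
    by (intro sum_nonneg add_nonneg_nonneg; simp)+
  have cut: "{1..n} = insert n {1..n-1}"
    using assms by auto
  have "casorati_defect n x = c / 2 * ?a + c * ?b + c / 2 * ?d + c * (x n n - s / c)\<^sup>2"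
    unfolding c_def s_def using casorati_defect_sum_of_squares[OF assms] .
  then have "casorati_defect n x = 0 \<longleftrightarrow> ?a = 0 \<and> ?b = 0 \<and> ?d = 0 \<and> x n n = s / c"
    using c nonneg by (simp add: add_nonneg_eq_0_iff)
  moreover have "?a = 0 \<and> ?b = 0 \<longleftrightarrow> ?off"
  proof -
    have "?a = 0 \<longleftrightarrow> (\<forall>i\<in>{1..n-1}. \<forall>j\<in>{1..n-1}-{i}. x i j = 0)"
      by (simp add: sum_nonneg_eq_0_iff sum_nonneg)
    moreover have "?b = 0 \<longleftrightarrow> (\<forall>i\<in>{1..n-1}. x i n = 0 \<and> x n i = 0)"
      by (simp add: sum_nonneg_eq_0_iff add_nonneg_eq_0_iff)
    moreover have notin: "n \<notin> {1..n-1}"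
      using assms by simp
    have "?off \<longleftrightarrow> (\<forall>i\<in>{1..n-1}. \<forall>j\<in>{1..n-1}-{i}. x i j = 0) \<and>
        (\<forall>i\<in>{1..n-1}. x i n = 0 \<and> x n i = 0)"
      unfolding cut using notin by (safe; metis Diff_iff insert_iff empty_iff)
    ultimately show ?thesis
      by argo
  qed
  moreover have "?d = 0 \<and> x n n = s / c \<longleftrightarrow> ?diag"
  proof -
    have "?d = 0 \<longleftrightarrow> (\<forall>i\<in>{1..n-1}. x i i = 2 * (s / c))"
      by (simp add: sum_nonneg_eq_0_iff)
    \<comment> \<open>If the first \<open>n - 1\<close> diagonal entries equal
      \<open>2 * x n n\<close>, the trace is \<open>(2 * (n - 1) + 1) * x n n\<close>, that is
      \<open>c * x n n\<close>, so the condition on the corner is automatic.\<close>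
    moreover have "x n n = s / c" if ?diag
    proof -
      have "s = x n n + (\<Sum>i=1..n-1. x i i)"
        unfolding s_def cut using assms by (subst sum.insert) auto
      also have "\<dots> = x n n + (\<Sum>i=1..n-1. 2 * x n n)"
        using that by simp
      also have "\<dots> = c * x n n"
        using assms by (simp add: c_def of_nat_diff algebra_simps)
      finally show ?thesis
        using c by simp
    qed
    ultimately show ?thesis
      by fastforce
  qed
  ultimately show ?thesis
    by blast
qed

text \<open>The scalar curvature sums over pairs \<open>i < j\<close>, whereas the norms run over
  all pairs. By symmetry the full sum counts each such pair twice and adds the diagonal; the
  induction adds one row and one column.\<close>

lemma double_sum_less_symmetric:
  fixes F :: "nat \<Rightarrow> nat \<Rightarrow> real"
  assumes "\<And>i j. i \<in> {1..n} \<Longrightarrow> j \<in> {1..n} \<Longrightarrow> F i j = F j i"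
  shows "2 * (\<Sum>j=1..n. \<Sum>i=1..<j. F i j) = (\<Sum>i=1..n. \<Sum>j=1..n. F i j) - (\<Sum>i=1..n. F i i)"
  using assms
proof (induction n)
  case (Suc n)
  have "(\<Sum>i=1..n. F i (Suc n)) = (\<Sum>i=1..n. F (Suc n) i)"
    using Suc.prems by (intro sum.cong refl) auto
  then show ?case
    using Suc by (simp add: sum.distrib atLeastLessThanSuc_atLeastAtMost)
qed simp


subsection \<open>Tangent spaces and bundle fibres\<close>

text \<open>The basis \<open>C\<close> is pulled back along \<open>f\<close>. Since \<open>f\<close>
  is linear only on \<open>V\<close>, its inverse is first taken on \<open>C\<close> and then
  extended to a globally linear \<open>G\<close>. The points where \<open>G\<close> inverts
  \<open>f\<close> form a subspace, so \<open>G\<close> is the inverse on all of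
  \<open>span C\<close>.\<close>

lemma linear_bij_on_fibre_basis:
  assumes V: "subspace V" and f: "linear_on_fibre V f" "bij_betw f V (span C)"
    and C: "finite C" "independent C"
  obtains C' where "finite C'" "span C' = V" "dim V = card C"
proof -
  obtain G where G: "linear G" "\<And>b. b \<in> C \<Longrightarrow> G b = inv_into V f b"
    using linear_independent_extend[OF C(2), of "inv_into V f"] by auto
  have GC: "G b \<in> V" "f (G b) = b" if "b \<in> C" for b
    using G(2)[OF that] f(2) span_base[OF that]
    by (simp_all add: bij_betw_def inv_into_into f_inv_into_f)
  have G_eq: "G x \<in> V \<and> f (G x) = x" if "x \<in> span C" for x
  proof -
    have "f 0 = 0"
      using f(1) V subspace_0 unfolding linear_on_fibre_def by (metis scaleR_zero_left)
    then have "subspace {x. G x \<in> V \<and> f (G x) = x}"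
      using f(1) V G(1) unfolding subspace_def linear_on_fibre_def
      by (simp add: linear_0 linear_add linear_scale)
    then have "span C \<subseteq> {x. G x \<in> V \<and> f (G x) = x}"
      using GC by (intro span_minimal) auto
    then show ?thesis
      using that by blast
  qed
  have inj: "inj_on G (span C)"
    by (rule inj_on_inverseI[where g=f]) (use G_eq in auto)
  have "v \<in> G ` span C" if "v \<in> V" for v
  proof -
    have "f v \<in> span C"
      using f(2) that by (auto simp: bij_betw_def)
    moreover have "G (f v) = v"
      using G_eq[OF calculation] f(2) that by (auto simp: bij_betw_def inj_on_def)
    ultimately show ?thesis
      by (metis image_eqI)
  qed
  then have span: "span (G ` C) = V"
    using G_eq linear_span_image[OF G(1), of C] by auto
  moreover have "independent (G ` C)"
    using linear_independent_injective_image[OF G(1) C(2) inj] .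
  ultimately have "dim V = card C"
    using inj by (metis dim_span_eq_card_independent card_image inj_on_subset span_superset)
  then show thesis
    using that[of "G ` C"] C(1) span by blast
qed

lemma model_fibre_basis:
  defines "\<delta> \<equiv> \<lambda>i k :: nat. if k = i then 1 else 0 :: real"
  shows "span (\<delta> ` {..<r}) = model_fibre r" "independent (\<delta> ` {..<r})" "card (\<delta> ` {..<r}) = r"
proof -
  have sum_apply: "(\<Sum>i\<in>I. F i) k = (\<Sum>i\<in>I. F i k)" for I :: "nat set" and F :: "nat \<Rightarrow> nat \<Rightarrow> real" and k
    by (induction I rule: infinite_finite_induct) auto
  have "\<delta> i = \<delta> j \<Longrightarrow> i = j" for i j
    unfolding \<delta>_def by (metis zero_neq_one)
  then have inj: "inj_on \<delta> {..<r}"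
    by (auto intro: inj_onI)
  then show "card (\<delta> ` {..<r}) = r"
    by (simp add: card_image)
  show "span (\<delta> ` {..<r}) = model_fibre r"
  proof
    have "subspace (model_fibre r)"
      by (auto simp: subspace_def model_fibre_def scaleR_fun_def)
    then show "span (\<delta> ` {..<r}) \<subseteq> model_fibre r"
      by (intro span_minimal) (auto simp: model_fibre_def \<delta>_def)
    show "model_fibre r \<subseteq> span (\<delta> ` {..<r})"
    proof
      fix x assume "x \<in> model_fibre r"
      then have "x = (\<Sum>i<r. x i *\<^sub>R \<delta> i)"
        by (auto simp: fun_eq_iff sum_apply model_fibre_def scaleR_fun_def \<delta>_def if_distrib not_less cong: if_cong)
      also have "\<dots> \<in> span (\<delta> ` {..<r})"
        by (intro span_sum span_scale span_base) auto
      finally show "x \<in> span (\<delta> ` {..<r})" .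
    qed
  qed
  show "independent (\<delta> ` {..<r})"
    unfolding dependent_def
  proof
    assume "\<exists>a\<in>\<delta> ` {..<r}. a \<in> span (\<delta> ` {..<r} - {a})"
    then obtain i where i: "\<delta> i \<in> span (\<delta> ` {..<r} - {\<delta> i})"
      by auto
    \<comment> \<open>All other unit sequences lie in the subspace of sequences vanishing at
      \<open>i\<close>, while \<open>\<delta> i\<close> does not.\<close>
    have "subspace {y :: nat \<Rightarrow> real. y i = 0}"
      by (auto simp: subspace_def scaleR_fun_def)
    then have "span (\<delta> ` {..<r} - {\<delta> i}) \<subseteq> {y. y i = 0}"
      by (intro span_minimal) (auto simp: \<delta>_def)
    with i show False
      by (auto simp: \<delta>_def)
  qed
qed

text \<open>A local trivialization transports the standard basis of the model fibre. The argument
  also covers rank 0, where a value 0 of \<open>dim\<close> by itself would not provide a finite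
  spanning set.\<close>

lemma vector_bundle_fibre:
  assumes "vector_bundle A r B \<Phi>"
  obtains C where "finite C" "span C = B p" "dim (B p) = r"
proof -
  obtain t where t: "t \<in> \<Phi>" "p \<in> fst t"
    using assms unfolding vector_bundle_def by blast
  then have "subspace (B p)" "linear_on_fibre (B p) (snd t p)"
    "bij_betw (snd t p) (B p) (model_fibre r)"
    using assms unfolding vector_bundle_def by blast+
  then show thesis
    using linear_bij_on_fibre_basis[of "B p" "snd t p"] that model_fibre_basis[of r]
    by (metis finite_imageI finite_lessThan)
qed

lemma smooth_on_differentiable:
  assumes "smooth_on S f" "x \<in> S"
  shows "f differentiable (at x)"
proof -
  have "Ck_on (Suc 0) S f"
    using assms(1) unfolding smooth_on_def by blast
  then show ?thesis
    using assms(2) by simp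
qed

section \<open>The tangent space of a smooth atlas as a vector space of the dimension of the model
  space\<close>

context
  fixes A :: "('p::{t2_space,second_countable_topology}, 'a::euclidean_space) chart set"
  assumes A: "smooth_atlas A"
begin

lemma chart_inverse:
  assumes "c \<in> A" "q \<in> fst c"
  shows "inv_into (fst c) (snd c) (snd c q) = q"
  using A assms by (auto simp: smooth_atlas_def is_chart_def homeomorphism_def)

lemma transition_apply:
  assumes "c \<in> A" "q \<in> fst c"
  shows "transition c d (snd c q) = snd d q"
  using chart_inverse[OF assms] by (simp add: transition_def)

text \<open>Overlaps of charts have open images in the model space, so derivatives of transition
  maps can be computed from identities valid only on such overlaps.\<close>

lemma open_chart_image:
  assumes c: "c \<in> A" and "open W" "W \<subseteq> fst c"
  shows "open (snd c ` W)"
proof -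
  have ch: "open (fst c)" "open (snd c ` fst c)"
    "homeomorphism (fst c) (snd c ` fst c) (snd c) (inv_into (fst c) (snd c))"
    using A c by (auto simp: smooth_atlas_def is_chart_def)
  have "openin (top_of_set (fst c)) W"
    using assms(2,3) by (simp add: open_subset)
  then have "openin (top_of_set (snd c ` fst c)) (snd c ` W)"
    using homeomorphism_imp_open_map[OF ch(3)] by blast
  then show ?thesis
    using ch(2) openin_open_trans by blast
qed

lemma transition_derivative:
  assumes "c \<in> A" "d \<in> A" "p \<in> fst c" "p \<in> fst d"
  shows "(transition c d has_derivative frechet_derivative (transition c d) (at (snd c p))) (at (snd c p))"
proof -
  have "smooth_on (snd c ` (fst c \<inter> fst d)) (transition c d)"
    using A assms by (auto simp: smooth_atlas_def)
  then have "transition c d differentiable (at (snd c p))"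
    using assms by (intro smooth_on_differentiable) auto
  then show ?thesis
    by (simp add: frechet_derivative_works)
qed

text \<open>\<open>transition c c\<close> is the identity on the open chart image only; outside it
  \<open>inv_into\<close> is unspecified. Agreement near the point suffices for the
  derivative.\<close>

lemma frechet_derivative_transition_self:
  assumes "c \<in> A" "p \<in> fst c"
  shows "frechet_derivative (transition c c) (at (snd c p)) = id"
proof -
  have "open (fst c)"
    using A assms by (auto simp: smooth_atlas_def is_chart_def)
  then have "(transition c c has_derivative id) (at (snd c p))"
    using assms open_chart_image[of c "fst c"]
    by (intro has_derivative_transform_within_open[OF has_derivative_id[unfolded id_def[symmetric]], of "snd c ` fst c"])
      (auto simp: transition_apply)
  then show ?thesis
    by (metis frechet_derivative_at)
qed

text \<open>The cocycle rule: this is the chain rule, since the direct transition agrees with the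
  composite on the open image of the triple overlap.\<close>

lemma frechet_derivative_transition_comp:
  assumes cs: "c \<in> A" "d \<in> A" "b \<in> A" and p: "p \<in> fst c" "p \<in> fst d" "p \<in> fst b"
  shows "frechet_derivative (transition c b) (at (snd c p)) w =
    frechet_derivative (transition d b) (at (snd d p)) (frechet_derivative (transition c d) (at (snd c p)) w)"
proof -
  let ?W = "fst c \<inter> fst d \<inter> fst b"
  have W: "open ?W"
    using A cs by (auto simp: smooth_atlas_def is_chart_def)
  have "(transition d b \<circ> transition c d has_derivative
      frechet_derivative (transition d b) (at (snd d p)) \<circ> frechet_derivative (transition c d) (at (snd c p)))
      (at (snd c p))"
    using diff_chain_at[OF transition_derivative[OF cs(1,2) p(1,2)]]
      transition_derivative[OF cs(2,3) p(2,3)] transition_apply[OF cs(1) p(1)] by metis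
  then have "(transition c b has_derivative
      frechet_derivative (transition d b) (at (snd d p)) \<circ> frechet_derivative (transition c d) (at (snd c p)))
      (at (snd c p))"
    using cs p open_chart_image[OF cs(1) W]
    by (elim has_derivative_transform_within_open[of _ _ _ _ "snd c ` ?W"])
      (auto simp: transition_apply)
  then show ?thesis
    by (metis frechet_derivative_at comp_apply)
qed

text \<open>The compatibility conditions between charts are linear, because derivatives are linear
  maps.\<close>

lemma subspace_tangent_space: "subspace (tangent_space A p)"
proof -
  let ?D = "\<lambda>c d. frechet_derivative (transition c d) (at (snd c p))"
  have lin: "linear (?D c d)" if "c \<in> A" "d \<in> A" "p \<in> fst c" "p \<in> fst d" for c d
    using transition_derivative[OF that] has_derivative_linear by blast
  have rep: "v d = ?D c d (v c)"
    if "v \<in> tangent_space A p" "c \<in> A" "d \<in> A" "p \<in> fst c" "p \<in> fst d" for v c d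
    using that unfolding tangent_space_def by blast
  have off: "v c = 0" if "v \<in> tangent_space A p" "\<not> (c \<in> A \<and> p \<in> fst c)" for v c
    using that unfolding tangent_space_def by blast
  have intro: "v \<in> tangent_space A p" if "\<And>c. \<not> (c \<in> A \<and> p \<in> fst c) \<Longrightarrow> v c = 0"
    "\<And>c d. c \<in> A \<Longrightarrow> d \<in> A \<Longrightarrow> p \<in> fst c \<Longrightarrow> p \<in> fst d \<Longrightarrow> v d = ?D c d (v c)" for v
    using that unfolding tangent_space_def by blast
  show ?thesis
  proof (rule subspaceI)
    show "0 \<in> tangent_space A p"
      by (rule intro) (simp_all add: lin linear_0)
    show "x + y \<in> tangent_space A p" if "x \<in> tangent_space A p" "y \<in> tangent_space A p" for x y
    proof (rule intro)
      show "(x + y) c = 0" if "\<not> (c \<in> A \<and> p \<in> fst c)" for c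
        using off[OF \<open>x \<in> _\<close> that] off[OF \<open>y \<in> _\<close> that] by simp
      show "(x + y) d = ?D c d ((x + y) c)"
        if c: "c \<in> A" "d \<in> A" "p \<in> fst c" "p \<in> fst d" for c d
        using rep[OF \<open>x \<in> _\<close> c] rep[OF \<open>y \<in> _\<close> c] linear_add[OF lin[OF c]] by simp
    qed
    show "r *\<^sub>R x \<in> tangent_space A p" if "x \<in> tangent_space A p" for r x
    proof (rule intro)
      show "(r *\<^sub>R x) c = 0" if "\<not> (c \<in> A \<and> p \<in> fst c)" for c
        using off[OF \<open>x \<in> _\<close> that] by (simp add: scaleR_fun_def)
      show "(r *\<^sub>R x) d = ?D c d ((r *\<^sub>R x) c)"
        if c: "c \<in> A" "d \<in> A" "p \<in> fst c" "p \<in> fst d" for c d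
        using rep[OF \<open>x \<in> _\<close> c] linear_scale[OF lin[OF c]] by (simp add: scaleR_fun_def)
    qed
  qed
qed

text \<open>Evaluation at one chart \<open>c\<close> around \<open>p\<close> is a linear bijection
  onto the model space. It is injective because the value at \<open>c\<close> determines the values
  at all charts, and surjective because \<open>coord_vector\<close> is compatible by the cocycle
  rule.\<close>

lemma tangent_space_spanning_dim:
  obtains C where "finite C" "span C = tangent_space A p" "dim (tangent_space A p) = DIM('a)"
proof -
  obtain c where c: "c \<in> A" "p \<in> fst c"
    using A unfolding smooth_atlas_def by blast
  have lin: "linear_on_fibre (tangent_space A p) (\<lambda>v. v c)"
    by (simp add: linear_on_fibre_def scaleR_fun_def)
  have "inj_on (\<lambda>v. v c) (tangent_space A p)"
  proof (rule inj_onI)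
    fix u v assume u: "u \<in> tangent_space A p" and v: "v \<in> tangent_space A p" and eq: "u c = v c"
    show "u = v"
    proof
      fix d show "u d = v d"
      proof (cases "d \<in> A \<and> p \<in> fst d")
        case True
        then have "w d = frechet_derivative (transition c d) (at (snd c p)) (w c)"
          if "w \<in> tangent_space A p" for w
          using that c unfolding tangent_space_def by blast
        then show ?thesis
          using u v eq by metis
      next
        case False
        then show ?thesis
          using u v unfolding tangent_space_def by (metis (mono_tags, lifting) mem_Collect_eq)
      qed
    qed
  qed
  moreover have "w \<in> (\<lambda>v. v c) ` tangent_space A p" for w
  proof (rule image_eqI[where x="coord_vector A c w p"])
    show "w = coord_vector A c w p c"
      using c by (simp add: coord_vector_def frechet_derivative_transition_self)
    show "coord_vector A c w p \<in> tangent_space A p"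
      unfolding tangent_space_def
    proof (intro CollectI conjI allI ballI impI)
      fix d b assume db: "d \<in> A" "b \<in> A" "p \<in> fst d \<and> p \<in> fst b"
      have "frechet_derivative (transition c b) (at (snd c p)) w =
          frechet_derivative (transition d b) (at (snd d p)) (frechet_derivative (transition c d) (at (snd c p)) w)"
        using frechet_derivative_transition_comp c db by blast
      then show "coord_vector A c w p b =
          frechet_derivative (transition d b) (at (snd d p)) (coord_vector A c w p d)"
        using db by (simp only: coord_vector_def simp_thms if_True)
    next
      fix d assume "\<not> (d \<in> A \<and> p \<in> fst d)"
      then show "coord_vector A c w p d = 0"
        unfolding coord_vector_def by (rule if_not_P)
    qed
  qed
  ultimately have "bij_betw (\<lambda>v. v c) (tangent_space A p) (span Basis)"
    by (auto simp: bij_betw_def)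
  then show thesis
    using linear_bij_on_fibre_basis[OF subspace_tangent_space lin _ finite_Basis independent_Basis] that
    by metis
qed

end


subsection \<open>Casorati and scalar curvature at a point\<close>

locale fibre_form = tangent: inner_product_fibre V h + normal: inner_product_fibre W k
  for V :: "'v::real_vector set" and h and W :: "'w::real_vector set" and k +
  fixes \<zeta> :: "'v \<Rightarrow> 'v \<Rightarrow> 'w"
  assumes form_bilinear: "bilinear_on_fibre V \<zeta>"
    and form_in: "x \<in> V \<Longrightarrow> y \<in> V \<Longrightarrow> \<zeta> x y \<in> W"
    and form_commute: "x \<in> V \<Longrightarrow> y \<in> V \<Longrightarrow> \<zeta> x y = \<zeta> y x"
begin

text \<open>The Casorati curvature of a hyperplane uses bases of the hyperplane itself, so the
  structure must restrict to subspaces.\<close>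

lemma fibre_form_subspace:
  assumes "subspace U" "U \<subseteq> V"
  shows "fibre_form U h W k \<zeta>"
proof -
  have "inner_product_on U h" "bilinear_on_fibre U \<zeta>"
    using inner_product_on_subset[OF tangent.inner_product assms(2)]
      bilinear_on_fibre_subset[OF form_bilinear assms(2)] .
  moreover have "\<zeta> x y \<in> W" "\<zeta> x y = \<zeta> y x" if "x \<in> U" "y \<in> U" for x y
    using form_in form_commute subsetD[OF assms(2)] that by blast+
  ultimately show ?thesis
    using assms(1) by unfold_locales
qed

text \<open>For fixed \<open>x\<close> the sum of the
  \<open>k (\<zeta> x (e j)) (\<zeta> x (e j))\<close> is the trace of this form, to which basis
  independence applies.\<close>

lemma bilinear_inner_form:
  assumes x: "x \<in> V"
  shows "bilinear_on_fibre V (\<lambda>y z. k (\<zeta> x y) (\<zeta> x z))"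
proof -
  have lin: "linear_on_fibre V (\<zeta> x)"
    using form_bilinear x by (simp add: bilinear_on_fibre_def)
  have "linear_on_fibre V (\<lambda>y. k (\<zeta> x y) (\<zeta> x z))" if "z \<in> V" for z
    using lin normal.linear_left[OF form_in[OF x that]] form_in[OF x]
    by (simp add: linear_on_fibre_def)
  moreover have "linear_on_fibre V (\<lambda>y. k (\<zeta> x z) (\<zeta> x y))" if "z \<in> V" for z
    using lin normal.linear_right[OF form_in[OF x that]] form_in[OF x]
    by (simp add: linear_on_fibre_def)
  ultimately show ?thesis
    by (simp add: bilinear_on_fibre_def)
qed

text \<open>The bases are exchanged one argument at a time: the inner sum is a trace for fixed first
  argument, and symmetry of \<open>\<zeta>\<close> moves the remaining old basis into the inner
  position.\<close>

lemma form_norm_independent: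
  assumes e: "orthonormal_basis V h I e" "finite I" and e': "orthonormal_basis V h J e'" "finite J"
  shows "(\<Sum>i\<in>I. \<Sum>j\<in>I. k (\<zeta> (e i) (e j)) (\<zeta> (e i) (e j))) =
    (\<Sum>i\<in>J. \<Sum>j\<in>J. k (\<zeta> (e' i) (e' j)) (\<zeta> (e' i) (e' j)))"
proof -
  note eV = tangent.orthonormal_basis_in[OF e(1)] tangent.orthonormal_basis_in[OF e'(1)]
  note tr = tangent.trace_independent[OF e e' bilinear_inner_form]
  have "(\<Sum>i\<in>I. \<Sum>j\<in>I. k (\<zeta> (e i) (e j)) (\<zeta> (e i) (e j))) =
      (\<Sum>i\<in>I. \<Sum>j\<in>J. k (\<zeta> (e i) (e' j)) (\<zeta> (e i) (e' j)))"
    using tr[OF eV(1)] by (rule sum.cong[OF refl])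
  also have "\<dots> = (\<Sum>j\<in>J. \<Sum>i\<in>I. k (\<zeta> (e' j) (e i)) (\<zeta> (e' j) (e i)))"
    by (subst sum.swap) (intro sum.cong refl, simp add: form_commute eV)
  also have "\<dots> = (\<Sum>j\<in>J. \<Sum>i\<in>J. k (\<zeta> (e' j) (e' i)) (\<zeta> (e' j) (e' i)))"
    using tr[OF eV(2)] by (rule sum.cong[OF refl])
  finally show ?thesis .
qed

text \<open>Parseval in the normal fibre removes the frame \<open>f\<close>, which leaves the
  squared norm of \<open>\<zeta>\<close>.\<close>

lemma form_norm_components:
  assumes e: "orthonormal_basis V h I e" and f: "orthonormal_basis W k J f" "finite J"
  shows "(\<Sum>\<alpha>\<in>J. \<Sum>i\<in>I. \<Sum>j\<in>I. (k (\<zeta> (e i) (e j)) (f \<alpha>))\<^sup>2) =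
    (\<Sum>i\<in>I. \<Sum>j\<in>I. k (\<zeta> (e i) (e j)) (\<zeta> (e i) (e j)))"
proof -
  note eV = tangent.orthonormal_basis_in[OF e]
  have "(\<Sum>\<alpha>\<in>J. \<Sum>i\<in>I. \<Sum>j\<in>I. (k (\<zeta> (e i) (e j)) (f \<alpha>))\<^sup>2) =
      (\<Sum>i\<in>I. \<Sum>j\<in>I. \<Sum>\<alpha>\<in>J. (k (\<zeta> (e i) (e j)) (f \<alpha>))\<^sup>2)"
    by (subst sum.swap) (intro sum.cong refl sum.swap)
  also have "\<dots> = (\<Sum>i\<in>I. \<Sum>j\<in>I. k (\<zeta> (e i) (e j)) (\<zeta> (e i) (e j)))"
    using normal.parseval[OF f] form_in eV by (intro sum.cong refl) (simp add: power2_eq_square)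
  finally show ?thesis .
qed

lemma trace_norm_components:
  assumes e: "orthonormal_basis V h I e" and f: "orthonormal_basis W k J f" "finite J"
  shows "(\<Sum>\<alpha>\<in>J. (\<Sum>i\<in>I. k (\<zeta> (e i) (e i)) (f \<alpha>))\<^sup>2) =
    (\<Sum>i\<in>I. \<Sum>j\<in>I. k (\<zeta> (e i) (e i)) (\<zeta> (e j) (e j)))"
proof -
  note eV = tangent.orthonormal_basis_in[OF e]
  have "(\<Sum>\<alpha>\<in>J. (\<Sum>i\<in>I. k (\<zeta> (e i) (e i)) (f \<alpha>))\<^sup>2) =
      (\<Sum>\<alpha>\<in>J. \<Sum>i\<in>I. \<Sum>j\<in>I. k (\<zeta> (e i) (e i)) (f \<alpha>) * k (\<zeta> (e j) (e j)) (f \<alpha>))"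
    by (simp add: power2_eq_square sum_product)
  also have "\<dots> =
      (\<Sum>i\<in>I. \<Sum>j\<in>I. \<Sum>\<alpha>\<in>J. k (\<zeta> (e i) (e i)) (f \<alpha>) * k (\<zeta> (e j) (e j)) (f \<alpha>))"
    by (subst sum.swap) (intro sum.cong refl sum.swap)
  also have "\<dots> = (\<Sum>i\<in>I. \<Sum>j\<in>I. k (\<zeta> (e i) (e i)) (\<zeta> (e j) (e j)))"
    using normal.parseval[OF f] form_in eV by (intro sum.cong refl) simp
  finally show ?thesis .
qed

end

text \<open>The given \<open>e\<close> and \<open>f\<close> witness that the bases chosen by
  \<open>SOME\<close> are orthonormal. Both component sums then equal the same basis-free squared
  norm of \<open>\<zeta>\<close>.\<close>

lemma casorati_orthonormal:
  fixes g :: "'p \<Rightarrow> (('p, 'a::euclidean_space) chart \<Rightarrow> 'a) \<Rightarrow> (('p, 'a) chart \<Rightarrow> 'a) \<Rightarrow> real"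
    and gB :: "'p \<Rightarrow> 'b::real_vector \<Rightarrow> 'b \<Rightarrow> real"
  assumes "fibre_form P (g p) (B p) (gB p) (\<zeta> p)"
    and e: "orthonormal_basis P (g p) {1..k} e"
    and f: "orthonormal_basis (B p) (gB p) {DIM('a)+1..DIM('a) + dim (B p)} f"
  shows "casorati g B gB \<zeta> p P =
    1 / real k * (\<Sum>\<alpha>=DIM('a)+1..DIM('a) + dim (B p). \<Sum>i=1..k. \<Sum>j=1..k.
      (gB p (\<zeta> p (e i) (e j)) (f \<alpha>))\<^sup>2)"
proof -
  interpret fibre_form P "g p" "B p" "gB p" "\<zeta> p" by fact
  have k: "dim P = k"
    using tangent.orthonormal_inj_independent(3)[OF e] by simp
  define e' where "e' = (SOME e. orthonormal_basis P (g p) {1..k} e)"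
  define f' where "f' = (SOME f. orthonormal_basis (B p) (gB p) {DIM('a)+1..DIM('a) + dim (B p)} f)"
  have e': "orthonormal_basis P (g p) {1..k} e'"
    unfolding e'_def by (rule someI[of "orthonormal_basis P (g p) {1..k}", OF e])
  have f': "orthonormal_basis (B p) (gB p) {DIM('a)+1..DIM('a) + dim (B p)} f'"
    unfolding f'_def
    by (rule someI[of "orthonormal_basis (B p) (gB p) {DIM('a)+1..DIM('a) + dim (B p)}", OF f])
  show ?thesis
    unfolding casorati_def Let_def k e'_def[symmetric] f'_def[symmetric]
      form_norm_components[OF e' f' finite_atLeastAtMost]
      form_norm_components[OF e f finite_atLeastAtMost]
      form_norm_independent[OF e' finite_atLeastAtMost e finite_atLeastAtMost] ..
qed

section \<open>The inequality and its equality case at a fixed point\<close>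

locale gauss_point =
  fibre_form "tangent_space A p" "g p" "B p" "gB p" "\<zeta> p"
  for A :: "('p::topological_space, 'a::euclidean_space) chart set"
    and g :: "'p \<Rightarrow> (('p, 'a) chart \<Rightarrow> 'a) \<Rightarrow> (('p, 'a) chart \<Rightarrow> 'a) \<Rightarrow> real"
    and B :: "'p \<Rightarrow> 'b::real_vector set"
    and gB :: "'p \<Rightarrow> 'b \<Rightarrow> 'b \<Rightarrow> real"
    and \<zeta> :: "'p \<Rightarrow> (('p, 'a) chart \<Rightarrow> 'a) \<Rightarrow> (('p, 'a) chart \<Rightarrow> 'a) \<Rightarrow> 'b"
    and p +
  fixes T :: "('p, 'a) tensor04" and n m :: nat
  assumes n_def: "n = DIM('a)" and n_ge: "n \<ge> 3"
    and dim_tangent: "dim (tangent_space A p) = n"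
    and m_def: "m = n + dim (B p)"
    and fibre_finite: "\<exists>C. finite C \<and> span C = B p"
    and gauss: "algebraic_gauss_equation A gB \<zeta> T"
begin

abbreviation "component e f \<alpha> i j \<equiv> gB p (\<zeta> p (e i) (e j)) (f \<alpha>)"

lemma tangent_finite: "\<exists>C. finite C \<and> span C = tangent_space A p"
  using finite_spanning_set_of_dim_pos[OF tangent.subspace] dim_tangent n_ge by fastforce

text \<open>Normal frames are numbered from \<open>n + 1\<close> to \<open>m\<close>, so a frame
  numbered from 1 is shifted by \<open>n\<close>.\<close>

lemma fibre_orthonormal_basis_exists: "\<exists>f. orthonormal_basis (B p) (gB p) {n+1..m} f"
proof -
  obtain f where f: "orthonormal_basis (B p) (gB p) {1..dim (B p)} f"
    using normal.orthonormal_basis_exists fibre_finite by blast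
  have "(\<lambda>\<alpha>. \<alpha> - n) ` {n+1..m} = {1..dim (B p)}"
  proof (rule set_eqI)
    fix i show "i \<in> (\<lambda>\<alpha>. \<alpha> - n) ` {n+1..m} \<longleftrightarrow> i \<in> {1..dim (B p)}"
      unfolding m_def by (auto intro!: image_eqI[of _ _ "i + n"])
  qed
  then have "(\<lambda>\<alpha>. f (\<alpha> - n)) ` {n+1..m} = f ` {1..dim (B p)}"
    by (metis image_image)
  moreover have "gB p (f (i - n)) (f (j - n)) = (if i = j then 1 else 0)"
    if "i \<in> {n+1..m}" "j \<in> {n+1..m}" for i j
  proof -
    have "i - n \<in> {1..dim (B p)}" "j - n \<in> {1..dim (B p)}" "i - n = j - n \<longleftrightarrow> i = j"
      using that m_def by auto
    then show ?thesis
      using f unfolding orthonormal_basis_def by simp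
  qed
  ultimately show ?thesis
    using f by (intro exI[of _ "\<lambda>\<alpha>. f (\<alpha> - n)"]) (simp add: orthonormal_basis_def)
qed

lemma casorati_components:
  assumes "subspace P" "P \<subseteq> tangent_space A p" "orthonormal_basis P (g p) {1..k} e"
    and "orthonormal_basis (B p) (gB p) {n+1..m} f"
  shows "casorati g B gB \<zeta> p P =
    1 / real k * (\<Sum>\<alpha>=n+1..m. \<Sum>i=1..k. \<Sum>j=1..k. (component e f \<alpha> i j)\<^sup>2)"
  using casorati_orthonormal[of P g p B gB \<zeta> k e f] fibre_form_subspace[OF assms(1,2)] assms(3,4)
  unfolding n_def m_def by simp

text \<open>By the Gauss equation the sectional term of \<open>e' i\<close> and \<open>e' j\<close>
  is \<open>R i j\<close>, a product of diagonal values of \<open>\<zeta>\<close> minus a squared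
  norm. Summed over all pairs, these give the squared norm of the trace and the squared norm of
  \<open>\<zeta>\<close>, and both may be moved from the chosen basis \<open>e'\<close> to
  \<open>e\<close>.\<close>

lemma scalar_curvature_components:
  assumes e: "orthonormal_basis (tangent_space A p) (g p) {1..n} e"
    and f: "orthonormal_basis (B p) (gB p) {n+1..m} f"
  shows "2 * scalar_curvature A g T p =
    (\<Sum>\<alpha>=n+1..m. (\<Sum>i=1..n. component e f \<alpha> i i)\<^sup>2)
    - (\<Sum>\<alpha>=n+1..m. \<Sum>i=1..n. \<Sum>j=1..n. (component e f \<alpha> i j)\<^sup>2)"
proof -
  define e' where "e' = (SOME e. orthonormal_basis (tangent_space A p) (g p) {1..n} e)"
  have e': "orthonormal_basis (tangent_space A p) (g p) {1..n} e'"
    unfolding e'_def by (rule someI[of "orthonormal_basis (tangent_space A p) (g p) {1..n}", OF e])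
  note eV = tangent.orthonormal_basis_in[OF e'] tangent.orthonormal_basis_in[OF e]
  define R where "R = (\<lambda>i j. gB p (\<zeta> p (e' i) (e' i)) (\<zeta> p (e' j) (e' j))
    - gB p (\<zeta> p (e' i) (e' j)) (\<zeta> p (e' i) (e' j)))"
  have "scalar_curvature A g T p = (\<Sum>j=1..n. \<Sum>i=1..<j. T p (e' i) (e' j) (e' j) (e' i))"
    unfolding scalar_curvature_def Let_def e'_def n_def ..
  also have "\<dots> = (\<Sum>j=1..n. \<Sum>i=1..<j. R i j)"
  proof (intro sum.cong refl)
    fix i j assume "j \<in> {1..n}" "i \<in> {1..<j}"
    then have ij: "e' i \<in> tangent_space A p" "e' j \<in> tangent_space A p"
      using eV(1) by auto
    then show "T p (e' i) (e' j) (e' j) (e' i) = R i j"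
      using gauss form_commute[OF ij] unfolding algebraic_gauss_equation_def R_def by simp
  qed
  finally have "2 * scalar_curvature A g T p = (\<Sum>i=1..n. \<Sum>j=1..n. R i j) - (\<Sum>i=1..n. R i i)"
    using double_sum_less_symmetric[of n R] form_in form_commute eV(1)
    by (simp add: R_def normal.commute)
  \<comment> \<open>The diagonal terms \<open>R i i\<close> are identically 0.\<close>
  also have "\<dots> = (\<Sum>i=1..n. \<Sum>j=1..n. gB p (\<zeta> p (e' i) (e' i)) (\<zeta> p (e' j) (e' j)))
    - (\<Sum>i=1..n. \<Sum>j=1..n. gB p (\<zeta> p (e' i) (e' j)) (\<zeta> p (e' i) (e' j)))"
    by (simp add: R_def sum_subtractf)
  also have "(\<Sum>i=1..n. \<Sum>j=1..n. gB p (\<zeta> p (e' i) (e' j)) (\<zeta> p (e' i) (e' j))) =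
      (\<Sum>\<alpha>=n+1..m. \<Sum>i=1..n. \<Sum>j=1..n. (component e f \<alpha> i j)\<^sup>2)"
    unfolding form_norm_components[OF e f finite_atLeastAtMost]
    by (rule form_norm_independent[OF e' finite_atLeastAtMost e finite_atLeastAtMost])
  also have "(\<Sum>i=1..n. \<Sum>j=1..n. gB p (\<zeta> p (e' i) (e' i)) (\<zeta> p (e' j) (e' j))) =
      (\<Sum>\<alpha>=n+1..m. (\<Sum>i=1..n. component e' f \<alpha> i i)\<^sup>2)"
    by (rule trace_norm_components[OF e' f finite_atLeastAtMost, symmetric])
  also have "\<dots> = (\<Sum>\<alpha>=n+1..m. (\<Sum>i=1..n. component e f \<alpha> i i)\<^sup>2)"
  proof (rule sum.cong[OF refl])
    fix \<alpha> assume "\<alpha> \<in> {n+1..m}"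
    then have "bilinear_on_fibre (tangent_space A p) (\<lambda>x y. gB p (\<zeta> p x y) (f \<alpha>))"
      using form_bilinear form_in normal.linear_left[OF normal.orthonormal_basis_in[OF f]]
      by (simp add: bilinear_on_fibre_def linear_on_fibre_def)
    then have "(\<Sum>i=1..n. component e' f \<alpha> i i) = (\<Sum>i=1..n. component e f \<alpha> i i)"
      by (rule tangent.trace_independent[OF e' finite_atLeastAtMost e finite_atLeastAtMost])
    then show "(\<Sum>i=1..n. component e' f \<alpha> i i)\<^sup>2 = (\<Sum>i=1..n. component e f \<alpha> i i)\<^sup>2"
      by simp
  qed
  finally show ?thesis .
qed

text \<open>At a hyperplane attaining the supremum this is the difference between the two sides of
  the claimed inequality; at any other hyperplane it is at least that difference.\<close>

definition casorati_gap :: "(('p, 'a) chart \<Rightarrow> 'a) set \<Rightarrow> real" where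
  "casorati_gap P = 2 * casorati g B gB \<zeta> p (tangent_space A p)
    - (2 * real n - 1) / (2 * real n) * casorati g B gB \<zeta> p P
    - normalized_scalar_curvature A g T p"

lemma orthonormal_basis_hyperplane:
  assumes e: "orthonormal_basis (tangent_space A p) (g p) {1..n} e"
  shows "hyperplane A p (span (e ` {1..n-1}))"
    and "orthonormal_basis (span (e ` {1..n-1})) (g p) {1..n-1} e"
proof -
  note eV = tangent.orthonormal_basis_in[OF e]
  have "inj_on e {1..n}" "independent (e ` {1..n})"
    using tangent.orthonormal_inj_independent[OF e] by auto
  then have "inj_on e {1..n-1}" "independent (e ` {1..n-1})"
    by (auto elim!: inj_on_subset independent_mono)
  then have "dim (span (e ` {1..n-1})) = n - 1"
    by (metis dim_span_eq_card_independent card_image card_atLeastAtMost diff_Suc_1)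
  moreover have "span (e ` {1..n-1}) \<subseteq> tangent_space A p"
    using eV tangent.subspace by (intro span_minimal) auto
  ultimately show "hyperplane A p (span (e ` {1..n-1}))"
    by (simp add: hyperplane_def n_def)
  show "orthonormal_basis (span (e ` {1..n-1})) (g p) {1..n-1} e"
    using e by (auto simp: orthonormal_basis_def)
qed

text \<open>An orthonormal basis of \<open>P\<close> is completed by one unit normal vector, which
  receives index \<open>n\<close>. Thus every hyperplane is covered by the computation in adapted
  bases.\<close>

lemma hyperplane_orthonormal_basis:
  assumes P: "hyperplane A p P"
  shows "\<exists>e. orthonormal_basis (tangent_space A p) (g p) {1..n} e \<and> P = span (e ` {1..n-1})"
proof -
  have P': "subspace P" "P \<subseteq> tangent_space A p" "dim P = n - 1"
    using P by (auto simp: hyperplane_def n_def)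
  interpret P: fibre_form P "g p" "B p" "gB p" "\<zeta> p"
    using fibre_form_subspace[OF P'(1,2)] .
  obtain C where "finite C" "span C = P"
    using finite_spanning_set_of_dim_pos[OF P'(1)] P'(3) n_ge by auto
  then obtain e where e: "orthonormal_basis P (g p) {1..n-1} e"
    using P.tangent.orthonormal_basis_exists P'(3) by metis
  then obtain e' where e': "\<forall>i\<in>{1..n-1}. e' i = e i"
    "orthonormal_basis (tangent_space A p) (g p) {1..n} e'"
    using tangent.orthonormal_basis_extend[OF e P'(2)] tangent_finite dim_tangent by metis
  moreover have "e' ` {1..n-1} = e ` {1..n-1}"
    using e'(1) by (intro image_cong) auto
  ultimately show ?thesis
    using e unfolding orthonormal_basis_def by metis
qed

lemma casorati_gap_eq:
  assumes e: "orthonormal_basis (tangent_space A p) (g p) {1..n} e"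
    and f: "orthonormal_basis (B p) (gB p) {n+1..m} f"
  shows "casorati_gap (span (e ` {1..n-1})) =
    (\<Sum>\<alpha>=n+1..m. casorati_defect n (component e f \<alpha>)) / (real n * (real n - 1))"
proof -
  let ?P = "span (e ` {1..n-1})"
  let ?N = "\<Sum>\<alpha>=n+1..m. \<Sum>i=1..n. \<Sum>j=1..n. (component e f \<alpha> i j)\<^sup>2"
  let ?S = "\<Sum>\<alpha>=n+1..m. \<Sum>i=1..n-1. \<Sum>j=1..n-1. (component e f \<alpha> i j)\<^sup>2"
  let ?H = "\<Sum>\<alpha>=n+1..m. (\<Sum>i=1..n. component e f \<alpha> i i)\<^sup>2"
  have n: "real n \<noteq> 0" "real n - 1 \<noteq> 0" "real (n - 1) = real n - 1"
    using n_ge by auto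
  have "casorati g B gB \<zeta> p (tangent_space A p) = 1 / real n * ?N"
    using casorati_components[OF tangent.subspace subset_refl e f] .
  moreover have "casorati g B gB \<zeta> p ?P = 1 / real (n - 1) * ?S"
    using casorati_components[OF _ _ orthonormal_basis_hyperplane(2)[OF e] f]
      orthonormal_basis_hyperplane(1)[OF e] by (simp add: hyperplane_def)
  moreover have "normalized_scalar_curvature A g T p = (?H - ?N) / (real n * (real n - 1))"
    using scalar_curvature_components[OF e f]
    by (simp add: normalized_scalar_curvature_def n_def)
  moreover have "(\<Sum>\<alpha>=n+1..m. casorati_defect n (component e f \<alpha>)) =
      (2 * real n - 1) * ?N - (2 * real n - 1) / 2 * ?S - ?H"
    unfolding casorati_defect_def sum_subtractf sum_distrib_left ..
  \<comment> \<open>Over the common denominator, \<open>N\<close> collects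
    \<open>2 * (x - 1)\<close> from the Casorati curvature and 1 from the scalar curvature, hence
    the factor \<open>2 * x - 1\<close>.\<close>
  moreover have "2 * (1 / x * N) - (2 * x - 1) / (2 * x) * (1 / (x - 1) * S) - (H - N) / (x * (x - 1)) =
      ((2 * x - 1) * N - (2 * x - 1) / 2 * S - H) / (x * (x - 1))"
    if "x \<noteq> 0" "x - 1 \<noteq> 0" for x N S H :: real
    using that by (simp add: divide_simps) (simp add: algebra_simps)
  ultimately show ?thesis
    unfolding casorati_gap_def using n by simp
qed

lemma casorati_gap_nonneg:
  assumes P: "hyperplane A p P"
  shows "casorati_gap P \<ge> 0"
proof -
  obtain e f where ef: "orthonormal_basis (tangent_space A p) (g p) {1..n} e"
    "P = span (e ` {1..n-1})" "orthonormal_basis (B p) (gB p) {n+1..m} f"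
    using hyperplane_orthonormal_basis[OF P] fibre_orthonormal_basis_exists by blast
  then show ?thesis
    unfolding ef(2) casorati_gap_eq[OF ef(1,3)] using n_ge
    by (intro divide_nonneg_nonneg sum_nonneg casorati_defect_nonneg) auto
qed

lemma casorati_gap_eq_0_iff:
  assumes e: "orthonormal_basis (tangent_space A p) (g p) {1..n} e"
    and f: "orthonormal_basis (B p) (gB p) {n+1..m} f"
  shows "casorati_gap (span (e ` {1..n-1})) = 0 \<longleftrightarrow>
    (\<forall>\<alpha>\<in>{n+1..m}. \<forall>i\<in>{1..n}. \<forall>j\<in>{1..n}. i \<noteq> j \<longrightarrow> component e f \<alpha> i j = 0) \<and>
    (\<forall>\<alpha>\<in>{n+1..m}. \<forall>i\<in>{1..n-1}. component e f \<alpha> i i = 2 * component e f \<alpha> n n)"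
proof -
  have n: "n \<ge> 1" "real n * (real n - 1) \<noteq> 0"
    using n_ge by auto
  have "casorati_gap (span (e ` {1..n-1})) = 0 \<longleftrightarrow>
      (\<Sum>\<alpha>=n+1..m. casorati_defect n (component e f \<alpha>)) = 0"
    unfolding casorati_gap_eq[OF e f] using n(2) by simp
  also have "\<dots> \<longleftrightarrow> (\<forall>\<alpha>\<in>{n+1..m}. casorati_defect n (component e f \<alpha>) = 0)"
    by (intro sum_nonneg_eq_0_iff finite_atLeastAtMost casorati_defect_nonneg n)
  finally show ?thesis
    unfolding casorati_defect_eq_0_iff[OF n(1)] ball_conj_distrib .
qed

text \<open>Nonnegativity of the gap bounds the Casorati curvatures of all hyperplanes by one
  constant. Hence \<open>Sup\<close> is a genuine supremum of a nonempty bounded set, which gives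
  the second claim, and it obeys the same bound, which gives the first.\<close>

lemma normalized_scalar_curvature_le_delta_hat_casorati:
  shows "normalized_scalar_curvature A g T p \<le> delta_hat_casorati A g B gB \<zeta> p" (is "?\<tau> \<le> _")
    and "hyperplane A p P \<Longrightarrow> casorati g B gB \<zeta> p P \<le> sup_casorati A g B gB \<zeta> p"
proof -
  let ?X = "{casorati g B gB \<zeta> p P | P. hyperplane A p P}"
  define c where "c = (2 * real n - 1) / (2 * real n)"
  \<comment> \<open>The inequality \<open>casorati_gap P \<ge> 0\<close> solved for the Casorati
    curvature of \<open>P\<close>.\<close>
  define b where "b = (2 * casorati g B gB \<zeta> p (tangent_space A p) - ?\<tau>) / c"
  have c: "c > 0"
    using n_ge by (simp add: c_def)
  have le: "x \<le> b" if x: "x \<in> ?X" for x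
  proof -
    obtain P where P: "hyperplane A p P" "x = casorati g B gB \<zeta> p P"
      using x by blast
    have "c * x \<le> 2 * casorati g B gB \<zeta> p (tangent_space A p) - ?\<tau>"
      using casorati_gap_nonneg[OF P(1)] unfolding casorati_gap_def c_def P(2) by simp
    then show ?thesis
      using c by (simp add: b_def field_simps)
  qed
  have "bdd_above ?X"
    by (rule bdd_aboveI[OF le])
  then show "casorati g B gB \<zeta> p P \<le> sup_casorati A g B gB \<zeta> p" if "hyperplane A p P"
    unfolding sup_casorati_def using that by (intro cSup_upper) auto
  have "?X \<noteq> {}"
    using tangent.orthonormal_basis_exists tangent_finite dim_tangent
      orthonormal_basis_hyperplane(1) by blast
  then have "sup_casorati A g B gB \<zeta> p \<le> b"
    unfolding sup_casorati_def using le by (rule cSup_least)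
  then have "c * sup_casorati A g B gB \<zeta> p \<le> 2 * casorati g B gB \<zeta> p (tangent_space A p) - ?\<tau>"
    using c by (simp add: b_def field_simps)
  then show "?\<tau> \<le> delta_hat_casorati A g B gB \<zeta> p"
    by (simp add: delta_hat_casorati_def c_def n_def)
qed

text \<open>Forwards, a basis adapted to a maximizing hyperplane has gap 0, so its components have
  the special shape. Backwards, the hyperplane of the given basis has gap 0; replacing its Casorati
  curvature by the supremum can only lower the upper bound, so
  \<open>?\<delta> \<le> ?\<tau>\<close>, and the inequality already proved closes the
  circle.\<close>

lemma delta_hat_casorati_equality:
  assumes "\<exists>P. hyperplane A p P \<and> casorati g B gB \<zeta> p P = sup_casorati A g B gB \<zeta> p"
  shows "normalized_scalar_curvature A g T p = delta_hat_casorati A g B gB \<zeta> p \<longleftrightarrow>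
    (\<exists>e f. orthonormal_basis (tangent_space A p) (g p) {1..n} e \<and>
      orthonormal_basis (B p) (gB p) {n+1..m} f \<and>
      (\<forall>\<alpha>\<in>{n+1..m}. \<forall>i\<in>{1..n}. \<forall>j\<in>{1..n}. i \<noteq> j \<longrightarrow> component e f \<alpha> i j = 0) \<and>
      (\<forall>\<alpha>\<in>{n+1..m}. \<forall>i\<in>{1..n-1}. component e f \<alpha> i i = 2 * component e f \<alpha> n n))"
    (is "?\<tau> = ?\<delta> \<longleftrightarrow> ?R")
proof
  obtain P where P: "hyperplane A p P" "casorati g B gB \<zeta> p P = sup_casorati A g B gB \<zeta> p"
    using assms by blast
  obtain e f where ef: "orthonormal_basis (tangent_space A p) (g p) {1..n} e" "P = span (e ` {1..n-1})"
    "orthonormal_basis (B p) (gB p) {n+1..m} f"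
    using hyperplane_orthonormal_basis[OF P(1)] fibre_orthonormal_basis_exists by blast
  assume "?\<tau> = ?\<delta>"
  then have "casorati_gap P = 0"
    by (simp add: casorati_gap_def delta_hat_casorati_def P(2) flip: n_def)
  then show ?R
    using casorati_gap_eq_0_iff[OF ef(1,3)] ef by blast
next
  assume ?R
  then obtain e f where e: "orthonormal_basis (tangent_space A p) (g p) {1..n} e"
    and "casorati_gap (span (e ` {1..n-1})) = 0" (is "casorati_gap ?P = 0")
    using casorati_gap_eq_0_iff by blast
  moreover have "(2 * real n - 1) / (2 * real n) * casorati g B gB \<zeta> p ?P
      \<le> (2 * real n - 1) / (2 * real n) * sup_casorati A g B gB \<zeta> p"
    using normalized_scalar_curvature_le_delta_hat_casorati(2) orthonormal_basis_hyperplane(1)[OF e] n_ge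
    by (intro mult_left_mono) auto
  ultimately have "?\<delta> \<le> ?\<tau>"
    by (simp add: casorati_gap_def delta_hat_casorati_def flip: n_def)
  then show "?\<tau> = ?\<delta>"
    using normalized_scalar_curvature_le_delta_hat_casorati(1) by simp
qed

end

section \<open>Passage from the manifold and the bundle to a single point\<close>

theorem theorem4p6:
  fixes A :: "('p::{t2_space,second_countable_topology}, 'a::euclidean_space) chart set"
    and g :: "'p \<Rightarrow> (('p, 'a) chart \<Rightarrow> 'a) \<Rightarrow> (('p, 'a) chart \<Rightarrow> 'a) \<Rightarrow> real"
    and B :: "'p \<Rightarrow> 'b::real_vector set"
    and \<Phi> :: "('p, 'b) triv set"
    and gB :: "'p \<Rightarrow> 'b \<Rightarrow> 'b \<Rightarrow> real"
    and \<zeta> :: "'p \<Rightarrow> (('p, 'a) chart \<Rightarrow> 'a) \<Rightarrow> (('p, 'a) chart \<Rightarrow> 'a) \<Rightarrow> 'b"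
    and T :: "('p, 'a) tensor04"
    and n m :: nat
  assumes "n = DIM('a)" and "n \<ge> 3" and "m \<ge> n"
    and "riemannian_manifold A g"
    and "riemannian_vector_bundle A (m - n) B \<Phi> gB"
    and "symmetric_12_tensor_field A B \<zeta>"
    and "curvature_like A T"
    and "algebraic_gauss_equation A gB \<zeta> T"
  shows "\<forall>p. normalized_scalar_curvature A g T p \<le> delta_hat_casorati A g B gB \<zeta> p \<and>
    ((\<exists>P. hyperplane A p P \<and> casorati g B gB \<zeta> p P = sup_casorati A g B gB \<zeta> p) \<longrightarrow>
      (normalized_scalar_curvature A g T p = delta_hat_casorati A g B gB \<zeta> p \<longleftrightarrow>
        (\<exists>e f. orthonormal_basis (tangent_space A p) (g p) {1..n} e \<and>
           orthonormal_basis (B p) (gB p) {n+1..m} f \<and>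
           (\<forall>\<alpha>\<in>{n+1..m}. \<forall>i\<in>{1..n}. \<forall>j\<in>{1..n}. i \<noteq> j \<longrightarrow>
              gB p (\<zeta> p (e i) (e j)) (f \<alpha>) = 0) \<and>
           (\<forall>\<alpha>\<in>{n+1..m}. \<forall>i\<in>{1..n-1}.
              gB p (\<zeta> p (e i) (e i)) (f \<alpha>) = 2 * gB p (\<zeta> p (e n) (e n)) (f \<alpha>)))))"
proof
  fix p
  have vb: "vector_bundle A (m - n) B \<Phi>" and gB: "inner_product_on (B p) (gB p)"
    using assms(5) by (auto simp: riemannian_vector_bundle_def)
  have atlas: "smooth_atlas A" and g: "inner_product_on (tangent_space A p) (g p)"
    using assms(4) by (auto simp: riemannian_manifold_def)
  have B: "subspace (B p)"
    using vb by (simp add: vector_bundle_def)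
  obtain C where C: "finite C" "span C = B p" "dim (B p) = m - n"
    using vector_bundle_fibre[OF vb] .
  have dim: "dim (tangent_space A p) = n"
    using tangent_space_spanning_dim[OF atlas] assms(1) by metis
  \<comment> \<open>The rank \<open>m - n\<close> is a truncated difference, so
    \<open>m \<ge> n\<close> is what turns \<open>dim (B p) = m - n\<close> into
    \<open>m = n + dim (B p)\<close>.\<close>
  interpret gauss_point A g B gB \<zeta> p T n m
  proof
    show "subspace (tangent_space A p)"
      using subspace_tangent_space[OF atlas] .
    show "bilinear_on_fibre (tangent_space A p) (\<zeta> p)"
      using assms(6) by (simp add: symmetric_12_tensor_field_def)
    show "\<zeta> p x y \<in> B p" "\<zeta> p x y = \<zeta> p y x"
      if "x \<in> tangent_space A p" "y \<in> tangent_space A p" for x y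
      using assms(6) that unfolding symmetric_12_tensor_field_def by blast+
    show "\<exists>C. finite C \<and> span C = B p"
      using C by blast
  qed (use assms g gB B C dim in auto)
  show "normalized_scalar_curvature A g T p \<le> delta_hat_casorati A g B gB \<zeta> p \<and>
    ((\<exists>P. hyperplane A p P \<and> casorati g B gB \<zeta> p P = sup_casorati A g B gB \<zeta> p) \<longrightarrow>
      (normalized_scalar_curvature A g T p = delta_hat_casorati A g B gB \<zeta> p \<longleftrightarrow>
        (\<exists>e f. orthonormal_basis (tangent_space A p) (g p) {1..n} e \<and>
           orthonormal_basis (B p) (gB p) {n+1..m} f \<and>
           (\<forall>\<alpha>\<in>{n+1..m}. \<forall>i\<in>{1..n}. \<forall>j\<in>{1..n}. i \<noteq> j \<longrightarrow>
              gB p (\<zeta> p (e i) (e j)) (f \<alpha>) = 0) \<and>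
           (\<forall>\<alpha>\<in>{n+1..m}. \<forall>i\<in>{1..n-1}.
              gB p (\<zeta> p (e i) (e i)) (f \<alpha>) = 2 * gB p (\<zeta> p (e n) (e n)) (f \<alpha>)))))"
    using normalized_scalar_curvature_le_delta_hat_casorati(1) delta_hat_casorati_equality by blast
qed

end
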